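(* Let $(\mathcal{A}, \varphi)$ be a non-commutative probability space and let $a, b \in \mathcal{A}$ be such that $\varphi(a) = \varphi(b) = 0$. Let $(a_k)_{k\geq 1}$ be a sequence of freely independent copies of $a$ in $(\mathcal{A}, \varphi)$ and let $(b_k)_{k\geq 1}$ be a sequence of freely independent copies of $b$ in $(\mathcal{A}, \varphi)$. Let \[ S_n = \frac{1}{\sqrt{n}} \sum_{k=1}^n a_k \otimes b_k \in \mathcal{A} \otimes \mathcal{A}. \] Then for all $m \in \mathbb{N}$, \[ \lim_{n \to \infty} (\varphi \otimes \varphi)(S_n^m) = \begin{cases} 0 & \text{if } m \text{ is odd}, \\ |\mathrm{NC}_2(m)|\, \varphi(a^2)^{\frac{m}{2}} \varphi(b^2)^{\frac{m}{2}} & \text{if } m \text{ is even}. \end{cases} \] Thus, if $a$ and $b$ are self-adjoint elements with variance $1$, the limit in distribution of $S_n$ with respect to $\varphi \otimes \varphi$ as $n \to \infty$ is the semicircular distribution with variance $1$ (i.e. the limiting moments $\lim_{n \to \infty} (\varphi \otimes \varphi)(S_n^m)$, $m \in \mathbb{N}$, are those of the centred semicircular distribution of variance $1$).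
   Context: A non-commutative probability space is a pair $(\mathcal{A},\varphi)$ where $\mathcal{A}$ is a unital C$^*$-algebra and $\varphi:\mathcal{A}\to\mathbb{C}$ is a unital positive linear map (not assumed tracial). $\varphi\otimes\varphi$ is the product state on the C$^*$-tensor product $\mathcal{A}\otimes\mathcal{A}$. "Freely independent copies of $a$" means elements $a_1,a_2,\dots$ of $\mathcal{A}$ that are freely independent with respect to $\varphi$ and each have the same distribution with respect to $\varphi$ as $a$. No relation between the sequences $(a_k)$ and $(b_k)$ is assumed. The variance of a self-adjoint $x$ is $\varphi(x^2)-\varphi(x)^2$. $\mathrm{NC}_2(m)$ is the set of non-crossing pair partitions of $\{1,\dots,m\}$: partitions all of whose blocks have exactly two elements and such that whenever $v_1<w_1<v_2<w_2$ with $v_1,v_2$ in a block $V$ and $w_1,w_2$ in a block $W$, one has $V=W$. *)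

theory Defs
  imports "HOL-Analysis.Analysis"
begin

(* real_normed_algebra_1 demands norm 1 = 1, which excludes only the zero algebra;
   the latter carries no unital functional. *)

class cstar_algebra = real_normed_algebra_1 + banach +
  fixes scaleC :: "complex \<Rightarrow> 'a \<Rightarrow> 'a" (infixr "*\<^sub>C" 75)
    and adj :: "'a \<Rightarrow> 'a"
  assumes scaleC_add_right: "c *\<^sub>C (x + y) = c *\<^sub>C x + c *\<^sub>C y"
    and scaleC_add_left: "(c + d) *\<^sub>C x = c *\<^sub>C x + d *\<^sub>C x"
    and scaleC_scaleC: "c *\<^sub>C d *\<^sub>C x = (c * d) *\<^sub>C x"
    and scaleC_one: "1 *\<^sub>C x = x"
    and scaleC_of_real: "complex_of_real r *\<^sub>C x = r *\<^sub>R x"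
    and mult_scaleC_left: "(c *\<^sub>C x) * y = c *\<^sub>C (x * y)"
    and mult_scaleC_right: "x * (c *\<^sub>C y) = c *\<^sub>C (x * y)"
    and norm_scaleC: "norm (c *\<^sub>C x) = cmod c * norm x"
    and adj_adj: "adj (adj x) = x"
    and adj_add: "adj (x + y) = adj x + adj y"
    and adj_scaleC: "adj (c *\<^sub>C x) = cnj c *\<^sub>C adj x"
    and adj_mult: "adj (x * y) = adj y * adj x"
    and cstar_identity: "norm (adj x * x) = (norm x)\<^sup>2"

global_interpretation cvec: vector_space "scaleC :: complex \<Rightarrow> 'a \<Rightarrow> 'a::cstar_algebra"
  by unfold_locales
    (simp_all add: scaleC_add_right scaleC_add_left scaleC_scaleC scaleC_one)

definition self_adjoint :: "'a::cstar_algebra \<Rightarrow> bool" where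
  "self_adjoint x \<longleftrightarrow> adj x = x"

text \<open>A type of class \<^class>\<open>cstar_algebra\<close> together with such a functional is a
  non-commutative probability space.\<close>

definition state :: "('a::cstar_algebra \<Rightarrow> complex) \<Rightarrow> bool" where
  "state \<phi> \<longleftrightarrow> Vector_Spaces.linear scaleC (*) \<phi> \<and> \<phi> 1 = 1
     \<and> (\<forall>x. \<phi> (adj x * x) \<in> \<real>\<^sub>\<ge>\<^sub>0)"

definition variance :: "('a::cstar_algebra \<Rightarrow> complex) \<Rightarrow> 'a \<Rightarrow> complex" where
  "variance \<phi> x = \<phi> (x\<^sup>2) - (\<phi> x)\<^sup>2"

text \<open>Distribution and freeness refer to moments and to unital subalgebras; no adjoints of the
  given elements are involved. For self-adjoint elements this agrees with the notions
  formulated with *-moments and *-subalgebras, and in general it is implied by them.\<close>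

definition same_distribution ::
    "('a::cstar_algebra \<Rightarrow> complex) \<Rightarrow> 'a \<Rightarrow> 'a \<Rightarrow> bool" where
  "same_distribution \<phi> x y \<longleftrightarrow> (\<forall>p::nat. \<phi> (x ^ p) = \<phi> (y ^ p))"

definition generated_algebra :: "'a::cstar_algebra \<Rightarrow> 'a set" where
  "generated_algebra x = cvec.span (range (\<lambda>p::nat. x ^ p))"

definition free_subalgebras ::
    "('a::cstar_algebra \<Rightarrow> complex) \<Rightarrow> 'i set \<Rightarrow> ('i \<Rightarrow> 'a set) \<Rightarrow> bool" where
  "free_subalgebras \<phi> I A \<longleftrightarrow>
     (\<forall>is xs. is \<noteq> [] \<and> length xs = length is \<and> set is \<subseteq> I \<and> distinct_adj is
        \<and> (\<forall>j<length is. xs ! j \<in> A (is ! j) \<and> \<phi> (xs ! j) = 0)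
        \<longrightarrow> \<phi> (prod_list xs) = 0)"

definition freely_independent ::
    "('a::cstar_algebra \<Rightarrow> complex) \<Rightarrow> 'i set \<Rightarrow> ('i \<Rightarrow> 'a) \<Rightarrow> bool" where
  "freely_independent \<phi> I x \<longleftrightarrow> free_subalgebras \<phi> I (\<lambda>i. generated_algebra (x i))"

text \<open>The value of the sequence at index 0 is irrelevant.\<close>

definition free_copies ::
    "('a::cstar_algebra \<Rightarrow> complex) \<Rightarrow> 'a \<Rightarrow> (nat \<Rightarrow> 'a) \<Rightarrow> bool" where
  "free_copies \<phi> a as \<longleftrightarrow>
     freely_independent \<phi> {1..} as \<and> (\<forall>k\<ge>1. same_distribution \<phi> (as k) a)"

text \<open>The type \<open>'t\<close> with the map \<open>tens\<close> is a completion of the algebraic tensor product of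
  \<open>'a\<close> and \<open>'b\<close> for some C*-norm. The condition on independent sets says that the induced
  linear map from the algebraic tensor product into \<open>'t\<close> is injective. No particular C*-norm
  (minimal, maximal, ...) is singled out.\<close>

definition cstar_tensor_product ::
    "('a::cstar_algebra \<Rightarrow> 'b::cstar_algebra \<Rightarrow> 't::cstar_algebra) \<Rightarrow> bool" where
  "cstar_tensor_product tens \<longleftrightarrow>
     (\<forall>x. Vector_Spaces.linear scaleC scaleC (\<lambda>y. tens x y))
     \<and> (\<forall>y. Vector_Spaces.linear scaleC scaleC (\<lambda>x. tens x y))
     \<and> (\<forall>x y x' y'. tens x y * tens x' y' = tens (x * x') (y * y'))
     \<and> (\<forall>x y. adj (tens x y) = tens (adj x) (adj y))
     \<and> tens 1 1 = 1
     \<and> (\<forall>B f. finite B \<and> cvec.independent B \<and> (\<Sum>x\<in>B. tens x (f x)) = 0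
          \<longrightarrow> (\<forall>x\<in>B. f x = 0))
     \<and> closure (cvec.span (range (\<lambda>(x, y). tens x y))) = UNIV"

text \<open>A state is continuous, so by density there is at most one such \<open>\<psi>\<close>: the functional
  \<open>\<phi>\<^sub>1 \<otimes> \<phi>\<^sub>2\<close>.\<close>

definition product_state ::
    "('a::cstar_algebra \<Rightarrow> 'b::cstar_algebra \<Rightarrow> 't::cstar_algebra)
      \<Rightarrow> ('a \<Rightarrow> complex) \<Rightarrow> ('b \<Rightarrow> complex) \<Rightarrow> ('t \<Rightarrow> complex) \<Rightarrow> bool" where
  "product_state tens \<phi>1 \<phi>2 \<psi> \<longleftrightarrow>
     state \<psi> \<and> (\<forall>x y. \<psi> (tens x y) = \<phi>1 x * \<phi>2 y)"

definition normalized_tensor_sum ::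
    "('a::cstar_algebra \<Rightarrow> 'b::cstar_algebra \<Rightarrow> 't::cstar_algebra)
      \<Rightarrow> (nat \<Rightarrow> 'a) \<Rightarrow> (nat \<Rightarrow> 'b) \<Rightarrow> nat \<Rightarrow> 't" where
  "normalized_tensor_sum tens as bs n =
     (1 / sqrt (real n)) *\<^sub>R (\<Sum>k=1..n. tens (as k) (bs k))"

definition noncrossing :: "nat set set \<Rightarrow> bool" where
  "noncrossing P \<longleftrightarrow>
     (\<forall>V\<in>P. \<forall>W\<in>P. \<forall>v1\<in>V. \<forall>v2\<in>V. \<forall>w1\<in>W. \<forall>w2\<in>W.
        v1 < w1 \<and> w1 < v2 \<and> v2 < w2 \<longrightarrow> V = W)"

definition NC2 :: "nat \<Rightarrow> nat set set set" where
  "NC2 m = {P. partition_on {1..m} P \<and> (\<forall>V\<in>P. card V = 2) \<and> noncrossing P}"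

text \<open>The centred semicircular distribution of variance \<open>v > 0\<close>.\<close>

definition semicircular :: "real \<Rightarrow> real measure" where
  "semicircular v = density lborel (\<lambda>x. ennreal
     (indicator {- 2 * sqrt v..2 * sqrt v} x * sqrt (4 * v - x\<^sup>2) / (2 * pi * v)))"

text \<open>Convergence in distribution is convergence of all moments.\<close>

definition limit_distribution ::
    "('a::cstar_algebra \<Rightarrow> complex) \<Rightarrow> (nat \<Rightarrow> 'a) \<Rightarrow> real measure \<Rightarrow> bool" where
  "limit_distribution \<psi> S \<mu> \<longleftrightarrow>
     (\<forall>m::nat. (\<lambda>n. \<psi> (S n ^ m)) \<longlonglongrightarrow> complex_of_real (\<integral>x. x ^ m \<partial>\<mu>))"

end

theory Submission
  imports Defs
begin

text \<open>
  Expanding \<open>S\<^sub>n ^ m\<close> gives \<open>n\<close> to the power \<open>- m / 2\<close> times the sum of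
  \<open>\<phi> (a\<^sub>w) \<phi> (b\<^sub>w)\<close> over the words \<open>w\<close> of length \<open>m\<close> in the letters \<open>1, \<dots>, n\<close>. By freeness
  each summand depends only on the kernel of \<open>w\<close>, the partition of the positions according to
  their letters, and a kernel with \<open>k\<close> blocks is shared by \<open>n (n - 1) \<cdots> (n - k + 1)\<close> words.
  A kernel with a singleton block contributes 0 since the letters are centred; all others have
  at most \<open>m / 2\<close> blocks, and only the pair partitions among them survive the normalization.
  For these, cancelling adjacent equal letters computes the moment: it is a power of the second
  moment if the partition is non-crossing, and 0 otherwise because the cancellation
  then ends in a nonempty alternating word. The numbers of non-crossing pairings and the moments
  of the semicircular distribution both satisfy \<open>(m + 4) c(m + 2) = 4 (m + 1) c(m)\<close>.
\<close>

section \<open>Joint moments of free elements\<close>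

lemma partition_on_block_unique:
  assumes "partition_on A P" "V \<in> P" "W \<in> P" "x \<in> V" "x \<in> W"
  shows "V = W"
  using assms by (meson disjointD disjoint_iff partition_onD2)

section \<open>Polynomials evaluated in an algebra, and formal words in them\<close>

definition poly_eval :: "'a::cstar_algebra \<Rightarrow> complex poly \<Rightarrow> 'a" where
  "poly_eval x p = fold_coeffs (\<lambda>c r. c *\<^sub>C 1 + x * r) p 0"

lemma poly_eval_0 [simp]: "poly_eval x 0 = 0"
  by (simp add: poly_eval_def)

lemma poly_eval_pCons [simp]: "poly_eval x (pCons c p) = c *\<^sub>C 1 + x * poly_eval x p"
  by (cases "p = 0 \<and> c = 0") (auto simp: poly_eval_def)

lemma poly_eval_add: "poly_eval x (p + q) = poly_eval x p + poly_eval x q"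
  by (induction p q rule: poly_induct2) (simp_all add: scaleC_add_left algebra_simps)

lemma poly_eval_smult: "poly_eval x (smult c p) = c *\<^sub>C poly_eval x p"
  by (induction p) (simp_all add: scaleC_add_right scaleC_scaleC mult_scaleC_right)

lemma poly_eval_mult: "poly_eval x (p * q) = poly_eval x p * poly_eval x q"
  by (induction p)
    (simp_all add: poly_eval_add poly_eval_smult mult_scaleC_left algebra_simps)

lemma poly_eval_monom: "poly_eval x (monom c n) = c *\<^sub>C x ^ n"
  by (induction n) (simp_all add: monom_0 monom_Suc mult_scaleC_right)

lemma poly_eval_in_generated_algebra: "poly_eval x p \<in> generated_algebra x"
proof -
  have "poly_eval x p = (\<Sum>i\<le>degree p. coeff p i *\<^sub>C x ^ i)"
  proof -
    have sum: "poly_eval x (\<Sum>i\<in>A. f i) = (\<Sum>i\<in>A. poly_eval x (f i))" if "finite A" for f and A :: "nat set"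
      using that by induction (simp_all add: poly_eval_add)
    have "poly_eval x p = poly_eval x (\<Sum>i\<le>degree p. monom (coeff p i) i)"
      by (simp add: poly_as_sum_of_monoms)
    then show ?thesis
      by (simp add: sum poly_eval_monom)
  qed
  then show ?thesis
    unfolding generated_algebra_def
    by (metis (mono_tags, lifting) cvec.span_base cvec.span_scale cvec.span_sum rangeI)
qed

text \<open>Words are kept formal, as lists of indices and polynomials, so that one word can be
  evaluated in two families and the reduction to alternating centred words becomes an induction on
  syntax.\<close>

definition word_prod :: "('i \<Rightarrow> 'a::cstar_algebra) \<Rightarrow> ('i \<times> complex poly) list \<Rightarrow> 'a" where
  "word_prod x w = prod_list (map (\<lambda>(i, p). poly_eval (x i) p) w)"

lemma word_prod_simps [simp]:
  "word_prod x [] = 1"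
  "word_prod x ((i, p) # w) = poly_eval (x i) p * word_prod x w"
  "word_prod x (v @ w) = word_prod x v * word_prod x w"
  by (simp_all add: word_prod_def)

lemma word_prod_letters:
  "word_prod x (map (\<lambda>i. (i, [:0, 1:])) w) = prod_list (map x w)"
  by (induction w) (simp_all add: scaleC_one)

section \<open>Linearity of states and centring of factors\<close>

lemma
  assumes "state \<phi>"
  shows state_add: "\<phi> (x + y) = \<phi> x + \<phi> y"
    and state_scaleC: "\<phi> (c *\<^sub>C x) = c * \<phi> x"
    and state_scaleR: "\<phi> (r *\<^sub>R x) = of_real r * \<phi> x"
    and state_sum: "\<phi> (\<Sum>i\<in>S. f i) = (\<Sum>i\<in>S. \<phi> (f i))"
    and state_1: "\<phi> 1 = 1"
proof -
  interpret Vector_Spaces.linear scaleC "(*)" \<phi>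
    using assms by (simp add: state_def)
  show "\<phi> (x + y) = \<phi> x + \<phi> y" "\<phi> (c *\<^sub>C x) = c * \<phi> x"
    "\<phi> (\<Sum>i\<in>S. f i) = (\<Sum>i\<in>S. \<phi> (f i))"
    by (simp_all add: add scale sum)
  show "\<phi> (r *\<^sub>R x) = of_real r * \<phi> x"
    using scale[of "of_real r" x] by (simp add: scaleC_of_real)
  show "\<phi> 1 = 1" using assms by (simp add: state_def)
qed

lemma freely_independent_word_prod:
  assumes "freely_independent \<phi> I x" "w \<noteq> []" "fst ` set w \<subseteq> I" "distinct_adj (map fst w)"
    and "\<forall>(i, p)\<in>set w. \<phi> (poly_eval (x i) p) = 0"
  shows "\<phi> (word_prod x w) = 0"
proof -
  let ?is = "map fst w" and ?xs = "map (\<lambda>(i, p). poly_eval (x i) p) w"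
  have "\<phi> (prod_list ?xs) = 0"
    using assms unfolding freely_independent_def free_subalgebras_def
    by (elim allE[of _ ?is] allE[of _ ?xs] impE)
      (auto simp: case_prod_unfold poly_eval_in_generated_algebra)
  then show ?thesis by (simp add: word_prod_def)
qed

text \<open>Computing a joint moment of free elements: merge equal neighbours, then split each
  factor into its centred part and a multiple of 1; each step shortens the word or
  decreases the number of factors that are not centred.\<close>

lemma free_word_induct:
  fixes \<mu> :: "'i \<Rightarrow> complex poly \<Rightarrow> complex"
  assumes \<mu>: "\<And>i p c. \<mu> i (p - [:c:]) = \<mu> i p - c"
    and merge: "\<And>u i p q v. P (u @ (i, p * q) # v) \<Longrightarrow> P (u @ (i, p) # (i, q) # v)"
    and centre: "\<And>u i p v. P (u @ (i, p - [:\<mu> i p:]) # v) \<Longrightarrow> P (u @ v) \<Longrightarrow> P (u @ (i, p) # v)"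
    and alternating: "\<And>w. distinct_adj (map fst w) \<Longrightarrow> \<forall>(i, p)\<in>set w. \<mu> i p = 0 \<Longrightarrow> P w"
  shows "P w"
proof (induction "length w" arbitrary: w rule: less_induct)
  case shorter: less
  \<comment> \<open>Lexicographic measure: merging or deleting a factor lowers the length;
    subtracting the mean keeps the length and lowers this count of non-centred factors.\<close>
  let ?N = "\<lambda>w. length (filter (\<lambda>(i, p). \<mu> i p \<noteq> 0) w)"
  show ?case
    using shorter
  proof (induction "?N w" arbitrary: w rule: less_induct)
    case less
    consider (adj) "\<not> distinct_adj (map fst w)"
      | (bad) i p where "(i, p) \<in> set w" "\<mu> i p \<noteq> 0"
      | (alt) "distinct_adj (map fst w)" "\<forall>(i, p)\<in>set w. \<mu> i p = 0"
      by blast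
    then show ?case
    proof cases
      case adj
      then obtain k where k: "Suc k < length w" "fst (w ! k) = fst (w ! Suc k)"
        by (auto simp: distinct_adj_conv_nth)
      have "w = take k w @ w ! k # w ! Suc k # drop (Suc (Suc k)) w"
        using k(1) by (simp add: Cons_nth_drop_Suc)
      then obtain u i p q v where w: "w = u @ (i, p) # (i, q) # v"
        using k(2) by (metis prod.collapse)
      show ?thesis unfolding w by (rule merge, rule less.prems) (simp add: w)
    next
      case bad
      then obtain u v where w: "w = u @ (i, p) # v" by (meson split_list)
      show ?thesis unfolding w
      proof (rule centre)
        show "P (u @ v)" by (rule less.prems) (simp add: w)
        show "P (u @ (i, p - [:\<mu> i p:]) # v)"
          by (rule less.hyps) (use bad less.prems in \<open>auto simp: w \<mu>\<close>)
      qed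
    next
      case alt
      then show ?thesis by (rule alternating)
    qed
  qed
qed

lemma state_poly_eval_centre:
  assumes "state \<phi>"
  shows "\<phi> (u * poly_eval x (p - [:c:]) * v) = \<phi> (u * poly_eval x p * v) - c * \<phi> (u * v)"
proof -
  have "poly_eval x p = poly_eval x (p - [:c:]) + c *\<^sub>C 1"
    using poly_eval_add[of x "p - [:c:]" "[:c:]"] by simp
  then have "u * poly_eval x p * v = u * poly_eval x (p - [:c:]) * v + c *\<^sub>C (u * v)"
    by (simp add: distrib_left distrib_right mult_scaleC_left mult_scaleC_right)
  then show ?thesis
    by (simp add: state_add[OF assms] state_scaleC[OF assms])
qed

text \<open>In the inductions \<open>c\<close> is the mean of the factor: the first word on the
  right is then centred at that place, and the second has one factor fewer.\<close>

lemma state_word_prod_centre: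
  assumes "state \<phi>"
  shows "\<phi> (word_prod x (u @ (i, p) # v))
     = \<phi> (word_prod x (u @ (i, p - [:c:]) # v)) + c * \<phi> (word_prod x (u @ v))"
  using state_poly_eval_centre[OF assms, of "word_prod x u" "x i" p c "word_prod x v"]
  by (simp add: mult.assoc)

lemma state_poly_eval_diff_const:
  assumes "state \<phi>"
  shows "\<phi> (poly_eval x (p - [:c:])) = \<phi> (poly_eval x p) - c"
  using state_poly_eval_centre[OF assms, of 1 x p c 1] by (simp add: state_1[OF assms])

text \<open>Merging and centring use only the moments of the single elements, so one reduction
  serves both families. It ends in alternating centred words, on which freeness gives 0 on both
  sides, or in the empty word.\<close>

theorem free_joint_moments_eq:
  assumes st: "state \<phi>"
    and x: "freely_independent \<phi> I x" and y: "freely_independent \<phi> I y"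
    and xy: "\<And>i. i \<in> I \<Longrightarrow> same_distribution \<phi> (x i) (y i)"
    and w: "set w \<subseteq> I"
  shows "\<phi> (prod_list (map x w)) = \<phi> (prod_list (map y w))"
proof -
  have ev: "\<phi> (poly_eval (x i) p) = \<phi> (poly_eval (y i) p)" if "i \<in> I" for i p
  proof -
    have pw: "\<phi> (x i ^ n) = \<phi> (y i ^ n)" for n
      using xy[OF that] by (simp add: same_distribution_def)
    have "\<phi> (poly_eval (x i) (\<Sum>j\<in>A. monom (coeff p j) j)) = \<phi> (poly_eval (y i) (\<Sum>j\<in>A. monom (coeff p j) j))"
      if "finite A" for A
      using that
      by (induction A) (simp_all add: poly_eval_add poly_eval_monom state_add[OF st] state_scaleC[OF st] pw)
    from this[of "{..degree p}"] show ?thesis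
      by (simp add: poly_as_sum_of_monoms)
  qed
  have "fst ` set W \<subseteq> I \<longrightarrow> \<phi> (word_prod x W) = \<phi> (word_prod y W)" for W
  proof (induction W rule: free_word_induct[where \<mu> = "\<lambda>i p. \<phi> (poly_eval (x i) p)"])
    case (1 i p c)
    then show ?case by (rule state_poly_eval_diff_const[OF st])
  next
    case (2 u i p q v)
    then show ?case by (simp add: poly_eval_mult mult.assoc)
  next
    case (3 u i p v)
    then show ?case
      using state_word_prod_centre[OF st, of x u i p v "\<phi> (poly_eval (x i) p)"]
        state_word_prod_centre[OF st, of y u i p v "\<phi> (poly_eval (x i) p)"] by auto
  next
    case (4 w)
    show ?case
    proof (intro impI, cases "w = []")
      case False
      assume "fst ` set w \<subseteq> I"
      moreover from this have "\<forall>(i, p)\<in>set w. \<phi> (poly_eval (y i) p) = 0"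
        using 4(2) ev by force
      ultimately show "\<phi> (word_prod x w) = \<phi> (word_prod y w)"
        using freely_independent_word_prod[OF x False _ 4] freely_independent_word_prod[OF y False _ 4(1)]
        by simp
    qed simp
  qed
  from this[of "map (\<lambda>i. (i, [:0, 1:])) w"] w show ?thesis
    by (simp add: word_prod_letters image_image)
qed

text \<open>No other factor has index \<open>c\<close>, so merging never involves the factor
  \<open>(c, p)\<close>, and centring leaves it alone. It survives every reduction, and each final
  word is nonempty, alternating and centred, hence has moment 0 by freeness.\<close>

lemma free_word_prod_centred:
  assumes st: "state \<phi>" and x: "freely_independent \<phi> I x"
    and "\<phi> (poly_eval (x c) p) = 0" "c \<in> I" "c \<notin> fst ` set u \<union> fst ` set v"
      "fst ` set u \<union> fst ` set v \<subseteq> I"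
  shows "\<phi> (word_prod x (u @ (c, p) # v)) = 0"
proof -
  \<comment> \<open>The word is a variable with its splitting as a premise, because the reductions
    change \<open>u\<close> and \<open>v\<close> during the induction.\<close>
  have "fst ` set W \<subseteq> I \<longrightarrow> W = u @ (c, p) # v \<longrightarrow> c \<notin> fst ` set u \<union> fst ` set v \<longrightarrow>
      \<phi> (poly_eval (x c) p) = 0 \<longrightarrow> \<phi> (word_prod x W) = 0" for W u p v
  proof (induction W arbitrary: u p v rule: free_word_induct[where \<mu> = "\<lambda>i p. \<phi> (poly_eval (x i) p)"])
    case (1 i p c)
    then show ?case by (rule state_poly_eval_diff_const[OF st])
  next
    case (2 u' i p' q v')
    show ?case
    proof (intro impI)
      assume *: "fst ` set (u' @ (i, p') # (i, q) # v') \<subseteq> I"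
        "u' @ (i, p') # (i, q) # v' = u @ (c, p) # v"
        "c \<notin> fst ` set u \<union> fst ` set v" "\<phi> (poly_eval (x c) p) = 0"
      have "(\<exists>s. u = u' @ (i, p') # (i, q) # s \<and> v' = s @ (c, p) # v) \<or>
        (\<exists>s. u' = u @ (c, p) # s \<and> v = s @ (i, p') # (i, q) # v')"
        using *(2,3) by (auto simp: append_eq_append_conv2 append_eq_Cons_conv Cons_eq_append_conv)
      then show "\<phi> (word_prod x (u' @ (i, p') # (i, q) # v')) = 0"
      proof (elim disjE exE conjE)
        fix s assume s: "u = u' @ (i, p') # (i, q) # s" "v' = s @ (c, p) # v"
        show ?thesis
          using 2[of "u' @ (i, p' * q) # s" p v] * by (auto simp: s poly_eval_mult mult.assoc)
      next
        fix s assume s: "u' = u @ (c, p) # s" "v = s @ (i, p') # (i, q) # v'"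
        show ?thesis
          using 2[of u p "s @ (i, p' * q) # v'"] * by (auto simp: s poly_eval_mult mult.assoc)
      qed
    qed
  next
    case (3 u' i p' v')
    show ?case
    proof (intro impI)
      assume *: "fst ` set (u' @ (i, p') # v') \<subseteq> I"
        "u' @ (i, p') # v' = u @ (c, p) # v"
        "c \<notin> fst ` set u \<union> fst ` set v" "\<phi> (poly_eval (x c) p) = 0"
      let ?m = "\<phi> (poly_eval (x i) p')"
      have "(\<exists>s. u = u' @ (i, p') # s \<and> v' = s @ (c, p) # v) \<or>
        (\<exists>s. u' = u @ (c, p) # s \<and> v = s @ (i, p') # v') \<or>
        (u' = u \<and> i = c \<and> p' = p \<and> v' = v)"
        using *(2) by (auto simp: append_eq_append_conv2 append_eq_Cons_conv Cons_eq_append_conv)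
      then show "\<phi> (word_prod x (u' @ (i, p') # v')) = 0"
      proof (elim disjE exE conjE)
        fix s assume s: "u = u' @ (i, p') # s" "v' = s @ (c, p) # v"
        show ?thesis
          using 3(1)[of "u' @ (i, p' - [:?m:]) # s" p v] 3(2)[of "u' @ s" p v] *
            state_word_prod_centre[OF st, of x u' i p' v' ?m] by (auto simp: s)
      next
        fix s assume s: "u' = u @ (c, p) # s" "v = s @ (i, p') # v'"
        show ?thesis
          using 3(1)[of u p "s @ (i, p' - [:?m:]) # v'"] 3(2)[of u p "s @ v'"] *
            state_word_prod_centre[OF st, of x u' i p' v' ?m] by (auto simp: s)
      next
        \<comment> \<open>The factor \<open>(c, p)\<close> itself is selected; its mean
          \<open>?m\<close> is 0, so centring returns the same word.\<close>
        assume s: "u' = u" "i = c" "p' = p" "v' = v"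
        show ?thesis
          using 3(1)[of u p v] * by (auto simp: s)
      qed
    qed
  next
    case (4 w)
    then show ?case using freely_independent_word_prod[OF x _ _ 4] by blast
  qed
  from this[of "u @ (c, p) # v" u p v] assms show ?thesis by auto
qed

lemma free_moment_singleton:
  assumes "state \<phi>" "freely_independent \<phi> I x" "\<phi> (x c) = 0"
    and "set (u @ c # v) \<subseteq> I" "c \<notin> set u \<union> set v"
  shows "\<phi> (prod_list (map x (u @ c # v))) = 0"
proof -
  let ?l = "map (\<lambda>i. (i, [:0, 1:]))"
  have "\<phi> (word_prod x (?l u @ (c, [:0, 1:]) # ?l v)) = 0"
    by (rule free_word_prod_centred[OF assms(1,2)]) (use assms in \<open>auto simp: scaleC_one\<close>)
  then show ?thesis by (simp add: word_prod_letters scaleC_one)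
qed

text \<open>The pair is the square of the variable, taken as a single factor of index
  \<open>c\<close>. Its centred part contributes 0, as \<open>c\<close> occurs nowhere else, and its
  mean multiplies the word with the pair removed.\<close>

lemma free_moment_adjacent_pair:
  assumes "state \<phi>" "freely_independent \<phi> I x"
    and "set (u @ c # v) \<subseteq> I" "c \<notin> set u \<union> set v"
  shows "\<phi> (prod_list (map x (u @ c # c # v))) = \<phi> ((x c)\<^sup>2) * \<phi> (prod_list (map x (u @ v)))"
proof -
  let ?l = "map (\<lambda>i. (i, [:0, 1:]))" and ?m = "\<phi> ((x c)\<^sup>2)"
  let ?p = "[:0, 0, 1:] :: complex poly"
  have sq: "poly_eval (x c) ?p = (x c)\<^sup>2"
    by (simp add: power2_eq_square scaleC_one)
  have "\<phi> (word_prod x (?l u @ (c, ?p - [:?m:]) # ?l v)) = 0"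
  proof (rule free_word_prod_centred[OF assms(1,2)])
    show "\<phi> (poly_eval (x c) (?p - [:?m:])) = 0"
      by (simp only: state_poly_eval_diff_const[OF assms(1)] sq diff_self)
  qed (use assms in auto)
  then have "\<phi> (word_prod x (?l u @ (c, ?p) # ?l v)) = ?m * \<phi> (word_prod x (?l u @ ?l v))"
    using state_word_prod_centre[OF assms(1), of x "?l u" c ?p "?l v" ?m] by simp
  then show ?thesis
    by (simp only: word_prod_simps word_prod_letters sq) (simp add: power2_eq_square mult.assoc)
qed

section \<open>Words and their kernels\<close>

definition paired :: "'i list \<Rightarrow> bool" where
  "paired w \<longleftrightarrow> (\<forall>c\<in>set w. count_list w c = 2)"

definition crossing :: "'i list \<Rightarrow> bool" where
  "crossing w \<longleftrightarrow> (\<exists>p q r s. p < q \<and> q < r \<and> r < s \<and> s < length w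
     \<and> w ! p = w ! r \<and> w ! q = w ! s \<and> w ! p \<noteq> w ! q)"

lemma count_list_eq_card: "count_list w c = card {i. i < length w \<and> w ! i = c}"
proof -
  have "count_list w c = length (filter ((=) c) w)"
    by (simp add: count_list_eq_length_filter)
  also have "\<dots> = card {i. i < length w \<and> w ! i = c}"
    by (simp add: length_filter_conv_card eq_commute)
  finally show ?thesis .
qed

lemma paired_partner:
  assumes "paired w" "i < length w"
  obtains j where "j < length w" "j \<noteq> i" "w ! j = w ! i"
proof -
  have "card {j. j < length w \<and> w ! j = w ! i} = 2"
    using assms by (simp add: paired_def flip: count_list_eq_card)
  then have "\<not> {j. j < length w \<and> w ! j = w ! i} \<subseteq> {i}"
    using card_mono[of "{i}" "{j. j < length w \<and> w ! j = w ! i}"] by auto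
  then show ?thesis using that by blast
qed

text \<open>An innermost pair of equal letters is crossed by the letter after its left end.\<close>

lemma paired_distinct_adj_imp_crossing:
  assumes w: "paired w" "distinct_adj w" "w \<noteq> []"
  shows "crossing w"
proof -
  let ?P = "\<lambda>(p, r). p < r \<and> r < length w \<and> w ! p = w ! r"
  obtain j where "j < length w" "j \<noteq> 0" "w ! j = w ! 0"
    using paired_partner[OF w(1)] w(3) by (metis length_greater_0_conv)
  then have "?P (0, j)" by simp
  from ex_has_least_nat[of ?P, OF this, of "\<lambda>pr. snd pr - fst pr"]
  obtain pr where pr: "?P pr" "\<And>pr'. ?P pr' \<Longrightarrow> snd pr - fst pr \<le> snd pr' - fst pr'"
    by blast
  obtain p r where [simp]: "pr = (p, r)" by (cases pr)
  have p: "p < r" "r < length w" "w ! p = w ! r" using pr(1) by auto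
  have "w ! p \<noteq> w ! Suc p"
    using distinct_adj_nth[OF w(2), of p] p by simp
  with p have q: "Suc p < r" "w ! Suc p \<noteq> w ! r"
    by (metis Suc_lessI) (metis p(3) \<open>w ! p \<noteq> w ! Suc p\<close>)
  obtain s where s: "s < length w" "s \<noteq> Suc p" "w ! s = w ! Suc p"
    using paired_partner[OF w(1), of "Suc p"] p q by auto
  have "s \<noteq> p" "s \<noteq> r" using s q p by auto
  \<comment> \<open>The partner \<open>s\<close> of \<open>Suc p\<close> cannot lie inside the pair,
    since \<open>r - p\<close> is minimal, so the two pairs interleave as
    \<open>s, p, Suc p, r\<close> or as \<open>p, Suc p, r, s\<close>.\<close>
  then consider "s < p" | "Suc p < s" "s < r" | "r < s" using s(2) by linarith
  then show ?thesis
  proof cases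
    case 1
    then show ?thesis unfolding crossing_def
      using p q s by (intro exI[of _ s] exI[of _ p] exI[of _ "Suc p"] exI[of _ r]) auto
  next
    case 2
    with pr(2)[of "(Suc p, s)"] s p show ?thesis by simp
  next
    case 3
    then show ?thesis unfolding crossing_def
      using p q s by (intro exI[of _ p] exI[of _ "Suc p"] exI[of _ r] exI[of _ s]) auto
  qed
qed

text \<open>The only two occurrences of \<open>c\<close> are adjacent and leave no room for a
  position between them, so they take part in no crossing; all other positions correspond in
  order.\<close>

lemma crossing_remove_adjacent_pair:
  assumes c: "c \<notin> set u \<union> set v"
  shows "crossing (u @ c # c # v) \<longleftrightarrow> crossing (u @ v)"
proof
  let ?w = "u @ c # c # v" and ?k = "length u"
  \<comment> \<open>\<open>e\<close> is the increasing map from positions of \<open>u @ v\<close> to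
    those of \<open>?w\<close> that skips the two places holding \<open>c\<close>.\<close>
  define e where "e j = (if j < ?k then j else j + 2)" for j
  have e_nth: "?w ! e j = (u @ v) ! j" for j
    by (simp add: e_def nth_append nth_Cons')
  have e_less: "e i < e j \<longleftrightarrow> i < j" for i j
    by (auto simp: e_def)
  have e_len: "e j < length ?w \<longleftrightarrow> j < length (u @ v)" for j
    by (auto simp: e_def)
  show "crossing ?w" if "crossing (u @ v)"
  proof -
    from that obtain p q r s where "p < q" "q < r" "r < s" "s < length (u @ v)"
      "(u @ v) ! p = (u @ v) ! r" "(u @ v) ! q = (u @ v) ! s" "(u @ v) ! p \<noteq> (u @ v) ! q"
      unfolding crossing_def by blast
    then show ?thesis
      unfolding crossing_def
      by (intro exI[of _ "e p"] exI[of _ "e q"] exI[of _ "e r"] exI[of _ "e s"])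
        (simp only: e_nth e_less e_len simp_thms)
  qed
  have e_surj: "\<exists>j. i = e j" if "i \<noteq> ?k" "i \<noteq> Suc ?k" for i
    using that by (intro exI[of _ "if i < ?k then i else i - 2"]) (auto simp: e_def)
  have c_pos: "i = ?k \<or> i = Suc ?k" if "i < length ?w" "?w ! i = c" for i
  proof (rule ccontr)
    assume "\<not> ?thesis"
    then obtain j where "i = e j" using e_surj by blast
    then have "(u @ v) ! j = c" "j < length (u @ v)" using that e_nth e_len by auto
    then show False using c by (metis nth_mem set_append)
  qed
  have c_val: "?w ! ?k = c" "?w ! Suc ?k = c"
    by (simp_all add: nth_append)
  show "crossing (u @ v)" if "crossing ?w"
  proof -
    from that obtain p q r s where *: "p < q" "q < r" "r < s" "s < length ?w"
      "?w ! p = ?w ! r" "?w ! q = ?w ! s" "?w ! p \<noteq> ?w ! q"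
      unfolding crossing_def by blast
    \<comment> \<open>If it were \<open>c\<close>, then \<open>p\<close> and \<open>r\<close> would
      be the two adjacent places, with no room for \<open>q\<close>; likewise below for
      \<open>q\<close> and \<open>s\<close> around \<open>r\<close>.\<close>
    have "?w ! p \<noteq> c"
      using c_pos[of p] c_pos[of r] * by auto
    moreover have "?w ! q \<noteq> c"
      using c_pos[of q] c_pos[of s] * by auto
    ultimately obtain p' q' r' s' where "p = e p'" "q = e q'" "r = e r'" "s = e s'"
      using e_surj c_val * by metis
    with * show ?thesis
      unfolding crossing_def
      by (intro exI[of _ p'] exI[of _ q'] exI[of _ r'] exI[of _ s'])
        (simp only: e_nth e_less e_len simp_thms)
  qed
qed

text \<open>Cancelling an adjacent pair contributes a factor \<open>s\<close> and changes neither
  \<open>paired\<close> nor \<open>crossing\<close>. When no such pair is left, the word is empty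
  with moment 1, or alternating with moment 0 by freeness and then necessarily crossing.\<close>

theorem free_moment_paired:
  assumes st: "state \<phi>" and x: "freely_independent \<phi> I x"
    and mom: "\<And>c. c \<in> I \<Longrightarrow> \<phi> (x c) = 0" "\<And>c. c \<in> I \<Longrightarrow> \<phi> ((x c)\<^sup>2) = s"
  shows "set w \<subseteq> I \<Longrightarrow> paired w \<Longrightarrow>
    \<phi> (prod_list (map x w)) = (if crossing w then 0 else s ^ (length w div 2))"
proof (induction "length w" arbitrary: w rule: less_induct)
  case less
  show ?case
  proof (cases "distinct_adj w")
    case True
    show ?thesis
    proof (cases "w = []")
      case True
      then show ?thesis by (simp add: state_1[OF st] crossing_def)
    next
      case False
      have "\<phi> (word_prod x (map (\<lambda>i. (i, [:0, 1:])) w)) = 0"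
        using True False less.prems mom(1)
        by (intro freely_independent_word_prod[OF x])
          (auto simp: scaleC_one comp_def)
      then show ?thesis
        using paired_distinct_adj_imp_crossing[OF less.prems(2) True False]
        by (simp add: word_prod_letters)
    qed
  next
    case False
    then obtain k where k: "Suc k < length w" "w ! k = w ! Suc k"
      by (auto simp: distinct_adj_conv_nth)
    have "w = take k w @ w ! k # w ! Suc k # drop (Suc (Suc k)) w"
      using k(1) by (simp add: Cons_nth_drop_Suc)
    then obtain u c v where w: "w = u @ c # c # v"
      using k(2) by metis
    have "count_list w c = 2" using less.prems(2) by (simp add: paired_def w)
    then have c: "c \<notin> set u \<union> set v"
      by (simp add: w count_list_0_iff)
    have "paired (u @ v)"
      unfolding paired_def
    proof
      fix d assume d: "d \<in> set (u @ v)"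
      with less.prems(2) have "count_list w d = 2" by (auto simp: paired_def w)
      moreover have "c \<noteq> d" using c d by auto
      ultimately show "count_list (u @ v) d = 2" by (simp add: w)
    qed
    then have "\<phi> (prod_list (map x (u @ v))) = (if crossing (u @ v) then 0 else s ^ (length (u @ v) div 2))"
      using less.prems by (intro less.hyps) (auto simp: w)
    moreover have "\<phi> (prod_list (map x w)) = \<phi> ((x c)\<^sup>2) * \<phi> (prod_list (map x (u @ v)))"
      unfolding w using less.prems c by (intro free_moment_adjacent_pair[OF st x]) (auto simp: w)
    moreover have "\<phi> ((x c)\<^sup>2) = s" using mom(2) less.prems by (simp add: w)
    ultimately show ?thesis
      using crossing_remove_adjacent_pair[OF c] by (simp add: w)
  qed
qed

section \<open>Kernels of words\<close>

definition kernel :: "'i list \<Rightarrow> nat set set" where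
  "kernel w = (\<lambda>c. {j\<in>{1..length w}. w ! (j - 1) = c}) ` set w"

lemma kernel_block_nonempty: "c \<in> set w \<Longrightarrow> \<exists>j\<in>{1..length w}. w ! (j - 1) = c"
  by (metis (no_types, lifting) Suc_leI add_diff_cancel_left' atLeastAtMost_iff in_set_conv_nth
      le_add1 plus_1_eq_Suc)

lemma inj_on_kernel_block: "inj_on (\<lambda>c. {j\<in>{1..length w}. w ! (j - 1) = c}) (set w)"
  using kernel_block_nonempty by (fastforce intro: inj_onI)

lemma card_kernel_block: "card {j\<in>{1..length w}. w ! (j - 1) = c} = count_list w c"
proof -
  have "{j\<in>{1..length w}. w ! (j - 1) = c} = Suc ` {i. i < length w \<and> w ! i = c}"
    by (auto simp: image_iff Bex_def) (metis Suc_pred diff_Suc_1 Suc_le_lessD less_Suc_eq_le)+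
  then show ?thesis by (simp add: card_image count_list_eq_card)
qed

lemma partition_on_kernel: "partition_on {1..length w} (kernel w)"
proof (rule partition_onI)
  show "\<Union> (kernel w) = {1..length w}"
    unfolding kernel_def by (auto intro!: bexI[OF _ nth_mem])
qed (use kernel_block_nonempty in \<open>fastforce simp: kernel_def disjnt_def\<close>)+

lemma kernel_pairs_iff: "(\<forall>V\<in>kernel w. card V = 2) \<longleftrightarrow> paired w"
  using card_kernel_block[of w] by (auto simp: kernel_def paired_def)

text \<open>Distinct letters have distinct blocks, so the two patterns match. Points of the
  partition count from 1 and list positions from 0, hence the shifts by one.\<close>

lemma noncrossing_kernel_iff: "noncrossing (kernel w) \<longleftrightarrow> \<not> crossing w"
proof
  assume nc: "noncrossing (kernel w)"
  show "\<not> crossing w"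
  proof
    assume "crossing w"
    then obtain p q r s where *: "p < q" "q < r" "r < s" "s < length w"
      "w ! p = w ! r" "w ! q = w ! s" "w ! p \<noteq> w ! q"
      unfolding crossing_def by blast
    let ?B = "\<lambda>c. {j\<in>{1..length w}. w ! (j - 1) = c}"
    have "?B (w ! p) = ?B (w ! q)"
      using nc unfolding noncrossing_def
    proof (elim ballE impE)
      show "Suc p < Suc q \<and> Suc q < Suc r \<and> Suc r < Suc s" using * by simp
    qed (use * in \<open>auto simp: kernel_def\<close>)
    then show False
      using inj_onD[OF inj_on_kernel_block, of w "w ! p" "w ! q"] * by auto
  qed
next
  assume nc: "\<not> crossing w"
  show "noncrossing (kernel w)"
    unfolding noncrossing_def
  proof (intro ballI impI)
    fix V W v1 v2 w1 w2
    assume *: "V \<in> kernel w" "W \<in> kernel w" "v1 \<in> V" "v2 \<in> V" "w1 \<in> W" "w2 \<in> W"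
      "v1 < w1 \<and> w1 < v2 \<and> v2 < w2"
    then obtain c d where cd: "V = {j\<in>{1..length w}. w ! (j - 1) = c}" "W = {j\<in>{1..length w}. w ! (j - 1) = d}"
      by (auto simp: kernel_def)
    have "c = d"
    proof (rule ccontr)
      assume "c \<noteq> d"
      then have "crossing w"
        unfolding crossing_def using *(3-7) unfolding cd
        by (intro exI[of _ "v1 - 1"] exI[of _ "w1 - 1"] exI[of _ "v2 - 1"] exI[of _ "w2 - 1"] conjI)
          (simp; linarith)+
      then show False using nc by simp
    qed
    then show "V = W" using cd by simp
  qed
qed

lemma same_kernel_block_iff:
  assumes "i < length w" "j < length w"
  shows "(\<exists>V\<in>kernel w. Suc i \<in> V \<and> Suc j \<in> V) \<longleftrightarrow> w ! i = w ! j"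
  using assms by (auto simp: kernel_def)

lemma kernel_map:
  assumes "inj_on f (set w)"
  shows "kernel (map f w) = kernel w"
proof -
  have "{j\<in>{1..length w}. map f w ! (j - 1) = f c} = {j\<in>{1..length w}. w ! (j - 1) = c}"
    if "c \<in> set w" for c
    using that assms by (auto simp: inj_on_def)
  then show ?thesis by (simp add: kernel_def image_image)
qed

text \<open>Send a letter \<open>c\<close> of \<open>w\<close> to the letter of \<open>v\<close> at
  any position where \<open>w\<close> has \<open>c\<close>; equality of the kernels makes the chosen
  position immaterial and the map injective.\<close>

lemma kernel_eq_imp_map:
  assumes len: "length v = length w" and ker: "kernel v = kernel w"
  obtains f where "inj_on f (set w)" "v = map f w"
proof -
  have eq: "v ! i = v ! j \<longleftrightarrow> w ! i = w ! j" if "i < length w" "j < length w" for i j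
    using same_kernel_block_iff[of i v j] same_kernel_block_iff[of i w j] that len ker by simp
  define ix where "ix c = (SOME i. i < length w \<and> w ! i = c)" for c
  have ix: "ix c < length w \<and> w ! ix c = c" if "c \<in> set w" for c
    unfolding ix_def using that someI_ex[of "\<lambda>i. i < length w \<and> w ! i = c"]
    by (simp add: in_set_conv_nth)
  show ?thesis
  proof
    show "inj_on (\<lambda>c. v ! ix c) (set w)"
      by (rule inj_onI) (metis eq ix)
    show "v = map (\<lambda>c. v ! ix c) w"
      by (rule nth_equalityI) (use eq ix len in auto)
  qed
qed

text \<open>Writing at each position the block that contains it gives a word over blocks with kernel
  \<open>P\<close>; an injection of the finitely many blocks into the naturals then renames the
  letters.\<close>

lemma partition_on_imp_kernel:
  assumes P: "partition_on {1..m} P"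
  obtains w :: "nat list" where "length w = m" "kernel w = P"
proof -
  define blk where "blk j = (THE V. V \<in> P \<and> j \<in> V)" for j
  have blk: "blk j = V" if "V \<in> P" "j \<in> V" for j V
    unfolding blk_def
    by (rule the_equality) (use that partition_on_block_unique[OF P] in auto)
  have cover: "\<exists>V\<in>P. j \<in> V" if "j \<in> {1..m}" for j
    using that P by (auto simp: partition_on_def)
  have ne: "\<exists>j\<in>{1..m}. j \<in> V" "V \<subseteq> {1..m}" if "V \<in> P" for V
  proof -
    show "V \<subseteq> {1..m}" using that P by (auto simp: partition_on_def)
    moreover have "V \<noteq> {}" using that P by (auto simp: partition_on_def)
    ultimately show "\<exists>j\<in>{1..m}. j \<in> V" by blast
  qed
  define w where "w = map (\<lambda>i. blk (Suc i)) [0..<m]"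
  have [simp]: "length w = m" by (simp add: w_def)
  have nth: "w ! (j - 1) = blk j" if "j \<in> {1..m}" for j
    using that by (cases j) (auto simp: w_def simp del: upt_Suc)
  have block: "{j\<in>{1..m}. w ! (j - 1) = V} = V" if V: "V \<in> P" for V
  proof -
    have "blk j = V \<longleftrightarrow> j \<in> V" if j: "j \<in> {1..m}" for j
      using cover[OF j] blk V by metis
    then have "{j\<in>{1..m}. w ! (j - 1) = V} = {j\<in>{1..m}. j \<in> V}"
      using nth by (intro Collect_cong) metis
    then show ?thesis using ne(2)[OF V] by blast
  qed
  have set: "set w = P"
  proof
    show "set w \<subseteq> P"
    proof
      fix V assume "V \<in> set w"
      then obtain i where i: "i < m" "V = blk (Suc i)" by (auto simp: w_def)
      then obtain V' where "V' \<in> P" "Suc i \<in> V'" using cover[of "Suc i"] by auto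
      then show "V \<in> P" using blk i by simp
    qed
    show "P \<subseteq> set w"
    proof
      fix V assume V: "V \<in> P"
      then obtain j where j: "j \<in> {1..m}" "j \<in> V" using ne by blast
      then have "w ! (j - 1) = V" using nth blk V by simp
      then show "V \<in> set w" using j by (auto intro!: nth_mem)
    qed
  qed
  have ker: "kernel w = P"
    using block by (simp add: kernel_def set)
  obtain f :: "nat set \<Rightarrow> nat" where "inj_on f (set w)"
    using finite_imp_inj_to_nat_seg[of "set w"] by auto
  then show ?thesis using that[of "map f w"] kernel_map ker by auto
qed

lemma NC2_eq_kernel:
  assumes "partition_on {1..m} P" "length w = m" "kernel w = P"
  shows "P \<in> NC2 m \<longleftrightarrow> paired w \<and> \<not> crossing w"
  using assms kernel_pairs_iff[of w] noncrossing_kernel_iff[of w] by (auto simp: NC2_def)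

text \<open>The words are the injective renamings of \<open>w\<close>, hence as many as the
  injections from \<open>set w\<close> into \<open>A\<close>. If \<open>A\<close> is too small,
  truncated subtraction produces a factor 0, as it should.\<close>

lemma card_words_with_kernel:
  fixes w :: "'i list"
  assumes "finite A"
  shows "card {v. set v \<subseteq> A \<and> length v = length w \<and> kernel v = kernel w}
    = (\<Prod>i<card (set w). card A - i)"
proof -
  let ?F = "{f \<in> set w \<rightarrow>\<^sub>E A. inj_on f (set w)}"
  have "{v. set v \<subseteq> A \<and> length v = length w \<and> kernel v = kernel w} = (\<lambda>f. map f w) ` ?F" (is "?L = ?R")
  proof
    show "?R \<subseteq> ?L" using kernel_map by (fastforce simp: PiE_iff)
    show "?L \<subseteq> ?R"
    proof
      fix v assume v: "v \<in> ?L"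
      then obtain f where f: "inj_on f (set w)" "v = map f w"
        using kernel_eq_imp_map[of v w] by auto
      have "restrict f (set w) \<in> ?F"
        using f v by (auto simp: inj_on_def)
      moreover have "v = map (restrict f (set w)) w" using f by simp
      ultimately show "v \<in> ?R" by blast
    qed
  qed
  moreover have "inj_on (\<lambda>f. map f w) ?F"
  proof (rule inj_onI)
    fix f g assume "f \<in> ?F" "g \<in> ?F" "map f w = map g w"
    then show "f = g" by (auto intro!: PiE_ext[of f "set w" "\<lambda>_. A" g])
  qed
  moreover have "card ?F = (\<Prod>i<card (set w). card A - i)"
    using card_inj_on_subset_funcset[OF _ assms order_refl, of "set w"]
    by (simp add: atLeast0LessThan)
  ultimately show ?thesis by (simp add: card_image)
qed

section \<open>Counting non-crossing pairings\<close>

definition nc_pairings :: "nat set \<Rightarrow> nat set set set" where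
  "nc_pairings A = {P. partition_on A P \<and> (\<forall>V\<in>P. card V = 2) \<and> noncrossing P}"

lemma finite_nc_pairings: "finite A \<Longrightarrow> finite (nc_pairings A)"
  by (rule finite_subset[of _ "Pow (Pow A)"]) (auto simp: nc_pairings_def partition_on_def)

section \<open>Decomposition of a non-crossing pairing at the block of its last point\<close>

lemma partition_on_Un:
  assumes "partition_on A P" "partition_on B Q" "A \<inter> B = {}"
  shows "partition_on (A \<union> B) (P \<union> Q)"
  using assms by (auto simp: partition_on_def intro: disjoint_union)

lemma partition_on_insert_block:
  assumes "partition_on A P" "V \<noteq> {}" "V \<inter> A = {}"
  shows "partition_on (V \<union> A) (insert V P)"
  using assms by (auto simp: partition_on_def disjoint_def)

text \<open>In a pattern \<open>v1 < w1 < v2 < w2\<close> the point \<open>v2\<close> is not the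
  maximum \<open>b\<close>, so \<open>V\<close> is not \<open>{k, b}\<close>. Hence \<open>V\<close>
  lies on one side of \<open>k\<close>; since \<open>w1\<close> lies between points of
  \<open>V\<close>, the block \<open>W\<close> is on the same side, where \<open>noncrossing\<close>
  is known.\<close>

lemma nc_pairings_insert:
  assumes P1: "P1 \<in> nc_pairings {a..<k}" and P2: "P2 \<in> nc_pairings {Suc k..<b}" and k: "a \<le> k" "k < b"
  shows "insert {k, b} (P1 \<union> P2) \<in> nc_pairings {a..<Suc b}"
proof -
  have part: "partition_on {a..<k} P1" "partition_on {Suc k..<b} P2"
    and two: "\<forall>V\<in>P1. card V = 2" "\<forall>V\<in>P2. card V = 2"
    and nc: "noncrossing P1" "noncrossing P2"
    using P1 P2 by (auto simp: nc_pairings_def)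
  have sub: "V \<subseteq> {a..<k}" if "V \<in> P1" for V using that part by (auto simp: partition_on_def)
  have sub': "V \<subseteq> {Suc k..<b}" if "V \<in> P2" for V using that part by (auto simp: partition_on_def)
  have "partition_on ({k, b} \<union> ({a..<k} \<union> {Suc k..<b})) (insert {k, b} (P1 \<union> P2))"
    by (intro partition_on_insert_block partition_on_Un part) (use k in auto)
  moreover have "{k, b} \<union> ({a..<k} \<union> {Suc k..<b}) = {a..<Suc b}" using k by auto
  moreover have "noncrossing (insert {k, b} (P1 \<union> P2))"
    unfolding noncrossing_def
  proof (intro ballI impI)
    fix V W v1 v2 w1 w2
    assume V: "V \<in> insert {k, b} (P1 \<union> P2)" and W: "W \<in> insert {k, b} (P1 \<union> P2)"
      and v: "v1 \<in> V" "v2 \<in> V" and w: "w1 \<in> W" "w2 \<in> W" and lt: "v1 < w1 \<and> w1 < v2 \<and> v2 < w2"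
    have le: "x \<le> b" if "x \<in> U" "U \<in> insert {k, b} (P1 \<union> P2)" for x U
      using that(2)
    proof (elim insertE UnE)
      show ?thesis if "U = {k, b}" using that \<open>x \<in> U\<close> k by auto
      show ?thesis if "U \<in> P1" using sub[OF that] \<open>x \<in> U\<close> k by auto
      show ?thesis if "U \<in> P2" using sub'[OF that] \<open>x \<in> U\<close> by auto
    qed
    have "v2 < b" using le[OF w(2) W] lt by simp
    moreover have "\<not> (v1 \<in> {k, b} \<and> v2 \<in> {k, b} \<and> v2 < b)" using k lt by auto
    ultimately consider "V \<in> P1" | "V \<in> P2" using V v by blast
    then show "V = W"
    proof cases
      case 1
      have "w1 < k" "w1 < b" using sub[OF 1] v lt k by auto
      then have "W \<notin> P2" "W \<noteq> {k, b}" using sub'[of W] w(1) by fastforce+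
      then have "W \<in> P1" using W by blast
      then show ?thesis using nc(1) 1 v w lt unfolding noncrossing_def by meson
    next
      case 2
      have "k < w1" "w1 < b" using sub'[OF 2] v lt by auto
      then have "W \<notin> P1" "W \<noteq> {k, b}" using sub[of W] w(1) by fastforce+
      then have "W \<in> P2" using W by blast
      then show ?thesis using nc(2) 2 v w lt unfolding noncrossing_def by meson
    qed
  qed
  ultimately show ?thesis
    using two k by (auto simp: nc_pairings_def)
qed

text \<open>\<open>k\<close> is the partner of \<open>b\<close>. A block with points on both sides
  of \<open>k\<close> would cross \<open>{k, b}\<close>, so every other block falls into one of the
  two intervals.\<close>

lemma nc_pairings_split:
  assumes P: "P \<in> nc_pairings {a..<Suc b}" and ab: "a \<le> b"
  obtains k P1 P2 where "a \<le> k" "k < b" "P1 \<in> nc_pairings {a..<k}" "P2 \<in> nc_pairings {Suc k..<b}"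
    "P = insert {k, b} (P1 \<union> P2)"
proof -
  have part: "partition_on {a..<Suc b} P" and two: "\<And>V. V \<in> P \<Longrightarrow> card V = 2" and nc: "noncrossing P"
    using P by (auto simp: nc_pairings_def)
  have sub: "V \<subseteq> {a..<Suc b}" if "V \<in> P" for V using that part by (auto simp: partition_on_def)
  have ncD: "V = W" if "V \<in> P" "W \<in> P" "v1 \<in> V" "v2 \<in> V" "w1 \<in> W" "w2 \<in> W"
    "v1 < w1" "w1 < v2" "v2 < w2" for V W v1 v2 w1 w2
    using nc that unfolding noncrossing_def by meson
  have dj: "V = W" if "V \<in> P" "W \<in> P" "x \<in> V" "x \<in> W" for V W x
    using that partition_on_block_unique[OF part] by blast
  have "b \<in> \<Union>P" using part ab by (auto simp: partition_on_def)
  then obtain B where B: "B \<in> P" "b \<in> B" by blast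
  from two[OF B(1)] B(2) obtain k where k: "B = {k, b}" "k \<noteq> b"
    by (auto simp: card_2_iff doubleton_eq_iff)
  have kb: "a \<le> k" "k < b" using sub[OF B(1)] k by auto
  have side: "V \<subseteq> {a..<k} \<or> V \<subseteq> {Suc k..<b}" if V: "V \<in> P - {B}" for V
  proof (rule ccontr)
    assume neg: "\<not> ?thesis"
    have kb_V: "k \<notin> V" "b \<notin> V" using V B k dj[of V B] by auto
    have sub_V: "x \<in> {a..<k} \<or> x \<in> {Suc k..<b}" if "x \<in> V" for x
    proof -
      have "x \<noteq> k" "x \<noteq> b" using kb_V that by auto
      moreover have "a \<le> x" "x < Suc b" using sub[of V] V that by auto
      ultimately show ?thesis by auto
    qed
    with neg obtain x y where "x \<in> V" "x \<in> {a..<k}" "y \<in> V" "y \<in> {Suc k..<b}"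
      by blast
    then have "x \<in> V" "y \<in> V" "x < k" "k < y" "y < b" by auto
    then have "V = B"
      using ncD[of V B x y k b] V B k by simp
    then show False using V by simp
  qed
  define P1 where "P1 = {V\<in>P - {B}. V \<subseteq> {a..<k}}"
  define P2 where "P2 = {V\<in>P - {B}. V \<subseteq> {Suc k..<b}}"
  have eq: "P = insert {k, b} (P1 \<union> P2)"
    using side B k unfolding P1_def P2_def by blast
  have cover: "\<exists>V\<in>P. x \<in> V" if "x \<in> {a..<Suc b}" for x
    using that part by (auto simp: partition_on_def)
  have ne: "{} \<notin> P" using part by (simp add: partition_on_def)
  have sub_nc: "noncrossing Q" if "Q \<subseteq> P" for Q
    using nc that unfolding noncrossing_def by blast
  have "partition_on {a..<k} P1"
  proof (rule partition_onI)
    show "\<Union>P1 = {a..<k}"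
    proof
      show "{a..<k} \<subseteq> \<Union>P1"
      proof
        fix x assume x: "x \<in> {a..<k}"
        then obtain V where V: "V \<in> P" "x \<in> V" using cover[of x] kb by auto
        moreover from this x kb have "V \<noteq> B" using k by auto
        ultimately have "V \<subseteq> {a..<k}" using side[of V] x by fastforce
        then show "x \<in> \<Union>P1" using V \<open>V \<noteq> B\<close> by (auto simp: P1_def)
      qed
    qed (auto simp: P1_def)
  qed (use ne dj in \<open>auto simp: P1_def disjnt_def\<close>)
  moreover have "partition_on {Suc k..<b} P2"
  proof (rule partition_onI)
    show "\<Union>P2 = {Suc k..<b}"
    proof
      show "{Suc k..<b} \<subseteq> \<Union>P2"
      proof
        fix x assume x: "x \<in> {Suc k..<b}"
        then obtain V where V: "V \<in> P" "x \<in> V" using cover[of x] kb by auto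
        moreover from this x kb have "V \<noteq> B" using k by auto
        ultimately have "V \<subseteq> {Suc k..<b}" using side[of V] x by fastforce
        then show "x \<in> \<Union>P2" using V \<open>V \<noteq> B\<close> by (auto simp: P2_def)
      qed
    qed (auto simp: P2_def)
  qed (use ne dj in \<open>auto simp: P2_def disjnt_def\<close>)
  moreover have "noncrossing P1" "noncrossing P2"
    by (auto intro!: sub_nc simp: P1_def P2_def)
  ultimately have "P1 \<in> nc_pairings {a..<k}" "P2 \<in> nc_pairings {Suc k..<b}"
    using two by (auto simp: nc_pairings_def P1_def P2_def)
  then show ?thesis using that kb eq by blast
qed

lemma nc_pairings_empty: "nc_pairings {} = {{}}"
  by (auto simp: nc_pairings_def partition_on_def noncrossing_def)

lemma nc_pairings_singleton: "nc_pairings {a..<Suc a} = {}"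
proof -
  have False if P: "P \<in> nc_pairings {a..<Suc a}" for P
    by (rule nc_pairings_split[OF P]) simp_all
  then show ?thesis by blast
qed

lemma nc_pairings_Suc:
  assumes "a \<le> b"
  shows "nc_pairings {a..<Suc b} = (\<Union>k\<in>{a..<b}. (\<lambda>(P1, P2). insert {k, b} (P1 \<union> P2)) `
    (nc_pairings {a..<k} \<times> nc_pairings {Suc k..<b}))" (is "_ = ?R")
proof
  show "?R \<subseteq> nc_pairings {a..<Suc b}" using nc_pairings_insert by fastforce
  show "nc_pairings {a..<Suc b} \<subseteq> ?R"
  proof
    fix P assume "P \<in> nc_pairings {a..<Suc b}"
    then obtain k P1 P2 where "a \<le> k" "k < b" "P1 \<in> nc_pairings {a..<k}"
      "P2 \<in> nc_pairings {Suc k..<b}" "P = insert {k, b} (P1 \<union> P2)"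
      using assms by (rule nc_pairings_split)
    then show "P \<in> ?R"
      by (intro UN_I[of k] image_eqI[of _ _ "(P1, P2)"]) auto
  qed
qed

text \<open>The decomposition is unique: \<open>k\<close> is read off from the block of
  \<open>b\<close>, and \<open>P1\<close> and \<open>P2\<close> consist of the blocks contained in
  the respective intervals.\<close>

lemma card_nc_pairings_Suc:
  assumes "a \<le> b"
  shows "card (nc_pairings {a..<Suc b}) =
    (\<Sum>k=a..<b. card (nc_pairings {a..<k}) * card (nc_pairings {Suc k..<b}))"
proof -
  let ?f = "\<lambda>k (P1, P2). insert {k, b} (P1 \<union> P2)"
  let ?S = "\<lambda>k. nc_pairings {a..<k} \<times> nc_pairings {Suc k..<b}"
  have block: "V \<subseteq> A" if "P \<in> nc_pairings A" "V \<in> P" for P V A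
    using that by (auto simp: nc_pairings_def partition_on_def)
  have ne: "V \<noteq> {}" if "P \<in> nc_pairings A" "V \<in> P" for P V A
    using that by (auto simp: nc_pairings_def partition_on_def)
  have inj: "inj_on (?f k) (?S k)" if k: "k \<in> {a..<b}" for k
  proof -
    have left: "{V\<in>?f k (P1, P2). V \<subseteq> {a..<k}} = P1" and right: "{V\<in>?f k (P1, P2). V \<subseteq> {Suc k..<b}} = P2"
      if "(P1, P2) \<in> ?S k" for P1 P2
    proof -
      have P: "P1 \<in> nc_pairings {a..<k}" "P2 \<in> nc_pairings {Suc k..<b}" using that by auto
      have filter_eq: "{V\<in>insert B (Q \<union> R). V \<subseteq> A} = Q" "{V\<in>insert B (R \<union> Q). V \<subseteq> A} = Q"
        if "\<And>V. V \<in> Q \<Longrightarrow> V \<subseteq> A" "\<And>V. V \<in> R \<Longrightarrow> \<not> V \<subseteq> A" "\<not> B \<subseteq> A" for A B :: "nat set" and Q R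
        using that by blast+
      \<comment> \<open>Nonemptiness is essential: an empty block would be contained in both
        intervals.\<close>
      have "\<not> V \<subseteq> {a..<k}" if "V \<in> P2" for V
        using block[OF P(2) that] ne[OF P(2) that] by fastforce
      then show "{V\<in>?f k (P1, P2). V \<subseteq> {a..<k}} = P1"
        unfolding case_prod_conv by (intro filter_eq block[OF P(1)]) auto
      have "\<not> V \<subseteq> {Suc k..<b}" if "V \<in> P1" for V
        using block[OF P(1) that] ne[OF P(1) that] by fastforce
      then show "{V\<in>?f k (P1, P2). V \<subseteq> {Suc k..<b}} = P2"
        unfolding case_prod_conv by (intro filter_eq block[OF P(2)]) auto
    qed
    show ?thesis
    proof (rule inj_onI)
      fix p q assume pq: "p \<in> ?S k" "q \<in> ?S k" "?f k p = ?f k q"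
      have "fst p = {V\<in>?f k p. V \<subseteq> {a..<k}}" "snd p = {V\<in>?f k p. V \<subseteq> {Suc k..<b}}"
        using left[of "fst p" "snd p"] right[of "fst p" "snd p"] pq(1) by simp_all
      moreover have "fst q = {V\<in>?f k q. V \<subseteq> {a..<k}}" "snd q = {V\<in>?f k q. V \<subseteq> {Suc k..<b}}"
        using left[of "fst q" "snd q"] right[of "fst q" "snd q"] pq(2) by simp_all
      ultimately show "p = q" unfolding pq(3) by (metis prod_eqI)
    qed
  qed
  have "card (nc_pairings {a..<Suc b}) = (\<Sum>k=a..<b. card (?f k ` ?S k))"
    unfolding nc_pairings_Suc[OF assms]
  proof (rule card_UN_disjoint)
    show "\<forall>k\<in>{a..<b}. finite (?f k ` ?S k)" by (simp add: finite_nc_pairings)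
    have bV: "b \<notin> V" if "P \<in> nc_pairings {a..<k} \<and> k < b \<or> P \<in> nc_pairings {Suc k..<b}" "V \<in> P" for P V k
      using that block[of P _ V] by fastforce
    show "\<forall>i\<in>{a..<b}. \<forall>j\<in>{a..<b}. i \<noteq> j \<longrightarrow> ?f i ` ?S i \<inter> ?f j ` ?S j = {}"
    proof (intro ballI impI)
      fix i j assume ij: "i \<in> {a..<b}" "j \<in> {a..<b}" "i \<noteq> j"
      have "V = {k, b}" if "V \<in> ?f k (P1, P2)" "b \<in> V" "(P1, P2) \<in> ?S k" "k \<in> {a..<b}" for P1 P2 k V
        using that bV by auto
      note block_b = this
      show "?f i ` ?S i \<inter> ?f j ` ?S j = {}"
      proof (rule equals0I)
        fix P assume P: "P \<in> ?f i ` ?S i \<inter> ?f j ` ?S j"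
        then obtain p q where p: "P = ?f i p" and q: "P = ?f j q" "q \<in> ?S j"
          by (elim IntE imageE) (rule that)
        have "{i, b} \<in> ?f j (fst q, snd q)"
          using p q(1) by (simp add: case_prod_beta)
        then have "{i, b} = {j, b}"
          using block_b[of "{i, b}" j "fst q" "snd q"] q(2) ij by simp
        then show False using ij by (auto simp: doubleton_eq_iff)
      qed
    qed
  qed simp
  also have "\<dots> = (\<Sum>k=a..<b. card (nc_pairings {a..<k}) * card (nc_pairings {Suc k..<b}))"
    by (intro sum.cong refl) (simp add: card_image[OF inj] card_cartesian_product)
  finally show ?thesis .
qed

text \<open>Translation invariance comes from the recurrence rather than from a bijection: by
  induction on the length, its right-hand side does not depend on \<open>a\<close>.\<close>

lemma card_nc_pairings_interval:
  "card (nc_pairings {a..<a + l}) = card (nc_pairings {1..<Suc l})"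
proof (induction l arbitrary: a rule: less_induct)
  case (less l)
  show ?case
  proof (cases l)
    case (Suc r)
    have *: "card (nc_pairings {a..<a + Suc r}) =
      (\<Sum>i<r. card (nc_pairings {1..<Suc i}) * card (nc_pairings {1..<r - i}))" for a
    proof -
      have "card (nc_pairings {a..<a + Suc r}) =
        (\<Sum>k=a..<a+r. card (nc_pairings {a..<k}) * card (nc_pairings {Suc k..<a+r}))"
        using card_nc_pairings_Suc[of a "a + r"] by simp
      also have "\<dots> = (\<Sum>i<r. card (nc_pairings {a..<a+i}) * card (nc_pairings {a+i+1..<a+i+1+(r - i - 1)}))"
        by (rule sum.reindex_bij_witness[of _ "\<lambda>i. a + i" "\<lambda>k. k - a"]) (auto simp: add.commute)
      also have "\<dots> = (\<Sum>i<r. card (nc_pairings {1..<Suc i}) * card (nc_pairings {1..<r - i}))"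
      proof (intro sum.cong refl arg_cong2[of _ _ _ _ "(*)"])
        fix i assume "i \<in> {..<r}"
        then show "card (nc_pairings {a..<a + i}) = card (nc_pairings {1..<Suc i})"
          "card (nc_pairings {a + i + 1..<a + i + 1 + (r - i - 1)}) = card (nc_pairings {1..<r - i})"
          using less[of i a] less[of "r - i - 1" "a + i + 1"] by (simp_all add: Suc Suc_diff_Suc)
      qed
      finally show ?thesis .
    qed
    show ?thesis using *[of a] *[of 1] by (simp add: Suc)
  qed (simp add: nc_pairings_empty)
qed

section \<open>The Catalan-type recurrence and its generating function\<close>

lemma NC2_eq_nc_pairings: "NC2 m = nc_pairings {1..<Suc m}"
  by (simp add: NC2_def nc_pairings_def atLeastLessThanSuc_atLeastAtMost)

lemma card_NC2_0: "card (NC2 0) = 1"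
  by (simp add: NC2_eq_nc_pairings nc_pairings_empty)

lemma card_NC2_1: "card (NC2 (Suc 0)) = 0"
  using nc_pairings_singleton[of 1] by (simp add: NC2_eq_nc_pairings)

text \<open>Moving the enclosed interval to start at 1 by \<open>card_nc_pairings_interval\<close>
  turns the decomposition into a convolution, the form that matches the square of a power
  series.\<close>

lemma card_NC2_Suc_Suc: "card (NC2 (Suc (Suc m))) = (\<Sum>i\<le>m. card (NC2 i) * card (NC2 (m - i)))"
proof -
  have "card (NC2 (Suc (Suc m))) =
      (\<Sum>k=1..<Suc (Suc m). card (nc_pairings {1..<k}) * card (nc_pairings {Suc k..<Suc (Suc m)}))"
    using card_nc_pairings_Suc[of 1 "Suc (Suc m)"] by (simp add: NC2_eq_nc_pairings)
  also have "\<dots> = (\<Sum>i\<le>m. card (nc_pairings {1..<Suc i}) * card (nc_pairings {i + 2..<i + 2 + (m - i)}))"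
    by (rule sum.reindex_bij_witness[of _ Suc "\<lambda>k. k - 1"]) auto
  also have "\<dots> = (\<Sum>i\<le>m. card (NC2 i) * card (NC2 (m - i)))"
    by (simp only: card_nc_pairings_interval NC2_eq_nc_pairings)
  finally show ?thesis .
qed

text \<open>With \<open>T\<close> the generating function, \<open>F = 1 - 2X\<^sup>2T\<close> satisfies \<open>F\<^sup>2 = 1 - 4X\<^sup>2\<close>, hence the
  linear differential equation \<open>(1 - 4X\<^sup>2) F' = - 4 X F\<close>.\<close>

lemma card_NC2_recurrence: "real (m + 4) * card (NC2 (m + 2)) = 4 * real (m + 1) * card (NC2 m)"
proof -
  define t where "t m = real (card (NC2 m))" for m
  define T where "T = Abs_fps t"
  define F :: "real fps" where "F = 1 - 2 * (fps_X ^ 2 * T)"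
  \<comment> \<open>The convolution recurrence, read as a quadratic equation for the generating
    function.\<close>
  have T: "T = 1 + fps_X ^ 2 * T ^ 2"
  proof (rule fps_ext)
    fix n
    consider "n = 0" | "n = 1" | k where "n = Suc (Suc k)"
      by (metis One_nat_def not0_implies_Suc)
    then show "fps_nth T n = fps_nth (1 + fps_X ^ 2 * T ^ 2) n"
    proof cases
      case 3
      have "fps_nth (T ^ 2) k = t (Suc (Suc k))"
        by (simp add: T_def t_def card_NC2_Suc_Suc power2_eq_square fps_mult_nth atLeast0AtMost)
      then show ?thesis using 3 by (simp add: T_def fps_X_power_mult_nth)
    qed (simp_all add: T_def t_def card_NC2_0 card_NC2_1 fps_X_power_mult_nth)
  qed
  have "F ^ 2 = 1 - 4 * (fps_X ^ 2 * T) + 4 * (fps_X ^ 2 * (fps_X ^ 2 * T ^ 2))"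
    by (simp add: F_def power2_eq_square algebra_simps)
  also have "fps_X ^ 2 * T ^ 2 = T - 1" using T by (simp add: algebra_simps)
  finally have F2: "F ^ 2 = 1 - 4 * fps_X ^ 2" by (simp add: algebra_simps)
  have "fps_deriv (F ^ 2) = - 8 * fps_X"
    unfolding F2 by (simp add: fps_deriv_power)
  then have "2 * (F * fps_deriv F) = 2 * (- 4 * fps_X)"
    by (simp add: power2_eq_square mult.commute)
  then have FF': "F * fps_deriv F = - 4 * fps_X"
    by (simp only: mult_left_cancel[OF zero_neq_numeral[symmetric]])
  have "(1 - 4 * fps_X ^ 2) * fps_deriv F = F * (F * fps_deriv F)"
    unfolding F2[symmetric] by (simp add: power2_eq_square mult.assoc)
  also have "\<dots> = - 4 * fps_X * F" by (simp add: FF')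
  finally have ode: "fps_deriv F = 4 * (fps_X ^ 2 * fps_deriv F) - 4 * (fps_X * F)"
    by (simp add: algebra_simps)
  have F_nth: "fps_nth F (m + 2) = - 2 * t m" for m
    by (simp add: F_def numeral_fps_const fps_X_power_mult_nth T_def)
  \<comment> \<open>Compare coefficients at degree \<open>m + 3\<close>; the two terms on the right
    combine to \<open>4 * (m + 1)\<close> times the coefficient of \<open>F\<close> at
    \<open>m + 2\<close>.\<close>
  have "fps_nth (fps_deriv F) (m + 3) = 4 * fps_nth (fps_deriv F) (m + 1) - 4 * fps_nth F (m + 2)"
    by (subst ode) (simp add: numeral_fps_const fps_X_power_mult_nth)
  then have "real (m + 4) * fps_nth F (m + 4) = 4 * real (m + 2) * fps_nth F (m + 2) - 4 * fps_nth F (m + 2)"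
    by (simp add: algebra_simps)
  moreover have "fps_nth F (m + 4) = - 2 * t (m + 2)" using F_nth[of "m + 2"] by (simp add: numeral_eq_Suc)
  ultimately show ?thesis
    using F_nth[of m] by (simp add: t_def algebra_simps)
qed

section \<open>Moments of the semicircular distribution\<close>

text \<open>This is \<open>2 * pi\<close> times the moment; a gauge integral lets the fundamental
  theorem of calculus be used directly.\<close>

definition semicircle_moment :: "nat \<Rightarrow> real" where
  "semicircle_moment m = integral {-2..2} (\<lambda>x. x ^ m * sqrt (4 - x\<^sup>2))"

lemma semicircular_moment: "(\<integral>x. x ^ m \<partial>semicircular 1) = semicircle_moment m / (2 * pi)"
proof -
  let ?d = "\<lambda>x::real. indicator {-2..2} x * sqrt (4 - x\<^sup>2) / (2 * pi)"
  have nonneg: "0 \<le> ?d x" for x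
  proof (cases "x \<in> {-2..2}")
    case True
    then have "x\<^sup>2 \<le> 2\<^sup>2" by (intro abs_le_square_iff[THEN iffD1]) auto
    then show ?thesis by simp
  qed simp
  have cont: "continuous_on {-2..2} (\<lambda>x::real. x ^ m * sqrt (4 - x\<^sup>2) / (2 * pi))"
    by (intro continuous_intros) auto
  have "(\<integral>x. x ^ m \<partial>semicircular 1) = (\<integral>x. ?d x * x ^ m \<partial>lborel)"
    unfolding semicircular_def using nonneg
    by (subst integral_density) auto
  also have "\<dots> = set_lebesgue_integral lborel {-2..2} (\<lambda>x. x ^ m * sqrt (4 - x\<^sup>2) / (2 * pi))"
    unfolding set_lebesgue_integral_def by (intro Bochner_Integration.integral_cong) auto
  also have "\<dots> = integral {-2..2} (\<lambda>x. x ^ m * sqrt (4 - x\<^sup>2) / (2 * pi))"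
    by (rule set_borel_integral_eq_integral) (rule borel_integrable_atLeastAtMost'[OF cont])
  also have "\<dots> = semicircle_moment m / (2 * pi)"
    by (simp add: semicircle_moment_def)
  finally show ?thesis .
qed

lemma semicircle_moment_integral:
  "((\<lambda>x. x ^ m * sqrt (4 - x\<^sup>2)) has_integral semicircle_moment m) {-2..2}"
  unfolding semicircle_moment_def
  by (intro integrable_integral integrable_continuous_interval continuous_intros)

section \<open>Integration by parts against the semicircle\<close>

lemma four_minus_square_pos:
  assumes "x \<in> {-2<..<2::real}" shows "0 < 4 - x\<^sup>2"
proof -
  have "\<bar>x\<bar>\<^sup>2 < 2\<^sup>2" using assms by (intro power_strict_mono) auto
  then show ?thesis by simp
qed

text \<open>The integrand is the derivative of \<open>f\<close> times the power 3/2 of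
  \<open>4 - x^2\<close>, a function that vanishes at both endpoints.\<close>

lemma semicircle_moment_by_parts:
  fixes f f' :: "real \<Rightarrow> real"
  assumes "\<And>x. (f has_real_derivative f' x) (at x)"
  shows "((\<lambda>x. (f' x * (4 - x\<^sup>2) - 3 * (x * f x)) * sqrt (4 - x\<^sup>2)) has_integral 0) {-2..2}"
proof -
  let ?F = "\<lambda>x. f x * ((4 - x\<^sup>2) * sqrt (4 - x\<^sup>2))"
  have "continuous_on {-2..2} f"
    using assms by (meson DERIV_continuous_on has_field_derivative_at_within)
  then have "continuous_on {-2..2} ?F"
    by (intro continuous_intros)
  \<comment> \<open>The square root is not differentiable at 0, so the derivative is taken in the
    open interval; continuity covers the endpoints.\<close>
  moreover have "(?F has_vector_derivative (f' x * (4 - x\<^sup>2) - 3 * (x * f x)) * sqrt (4 - x\<^sup>2)) (at x)"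
    if x: "x \<in> {-2<..<2}" for x
  proof -
    have pos: "0 < 4 - x\<^sup>2" by (rule four_minus_square_pos[OF x])
    have "(?F has_real_derivative f' x * ((4 - x\<^sup>2) * sqrt (4 - x\<^sup>2)) +
        ((- 2 * x) * sqrt (4 - x\<^sup>2) + (- 2 * x) / (2 * sqrt (4 - x\<^sup>2)) * (4 - x\<^sup>2)) * f x) (at x)"
      using pos by (auto intro!: derivative_eq_intros assms simp: field_simps)
    moreover have "f' x * ((4 - x\<^sup>2) * sqrt (4 - x\<^sup>2)) +
        ((- 2 * x) * sqrt (4 - x\<^sup>2) + (- 2 * x) / (2 * sqrt (4 - x\<^sup>2)) * (4 - x\<^sup>2)) * f x
      = (f' x * (4 - x\<^sup>2) - 3 * (x * f x)) * sqrt (4 - x\<^sup>2)"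
    proof -
      have "(- 2 * x) / (2 * sqrt (4 - x\<^sup>2)) * (4 - x\<^sup>2) = - x * ((4 - x\<^sup>2) / sqrt (4 - x\<^sup>2))"
        by simp
      also have "(4 - x\<^sup>2) / sqrt (4 - x\<^sup>2) = sqrt (4 - x\<^sup>2)"
        using pos by (intro real_div_sqrt) simp
      finally show ?thesis by (simp only:) (simp add: algebra_simps)
    qed
    ultimately show ?thesis
      by (simp only: has_real_derivative_iff_has_vector_derivative)
  qed
  ultimately have "((\<lambda>x. (f' x * (4 - x\<^sup>2) - 3 * (x * f x)) * sqrt (4 - x\<^sup>2)) has_integral ?F 2 - ?F (-2)) {-2..2}"
    by (intro fundamental_theorem_of_calculus_interior) auto
  then show ?thesis by simp
qed

text \<open>Take \<open>f x = x ^ (m + 1)\<close> in the integration by parts and collect the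
  multiples of \<open>x ^ m\<close> and \<open>x ^ (m + 2)\<close>.\<close>

lemma semicircle_moment_recurrence:
  "real (m + 4) * semicircle_moment (m + 2) = 4 * real (m + 1) * semicircle_moment m"
proof -
  have "((\<lambda>x. (real (m + 1) * x ^ m * (4 - x\<^sup>2) - 3 * (x * x ^ (m + 1))) * sqrt (4 - x\<^sup>2)) has_integral 0) {-2..2}"
    by (rule semicircle_moment_by_parts) (use DERIV_pow[of "m + 1"] in simp)
  moreover have "(real (m + 1) * x ^ m * (4 - x\<^sup>2) - 3 * (x * x ^ (m + 1))) * sqrt (4 - x\<^sup>2) =
      4 * real (m + 1) * (x ^ m * sqrt (4 - x\<^sup>2)) - real (m + 4) * (x ^ (m + 2) * sqrt (4 - x\<^sup>2))" for x :: real
    by (simp add: power2_eq_square algebra_simps)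
  ultimately have "((\<lambda>x. 4 * real (m + 1) * (x ^ m * sqrt (4 - x\<^sup>2))
      - real (m + 4) * (x ^ (m + 2) * sqrt (4 - x\<^sup>2))) has_integral 0) {-2..2}"
    by (simp only:)
  moreover have "((\<lambda>x. 4 * real (m + 1) * (x ^ m * sqrt (4 - x\<^sup>2)) - real (m + 4) * (x ^ (m + 2) * sqrt (4 - x\<^sup>2)))
    has_integral 4 * real (m + 1) * semicircle_moment m - real (m + 4) * semicircle_moment (m + 2)) {-2..2}"
    by (intro has_integral_diff has_integral_mult_right semicircle_moment_integral)
  ultimately have "0 = 4 * real (m + 1) * semicircle_moment m - real (m + 4) * semicircle_moment (m + 2)"
    by (rule has_integral_unique)
  then show ?thesis by simp
qed

lemma semicircle_moment_1: "semicircle_moment (Suc 0) = 0"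
proof -
  have "((\<lambda>x. (0 * (4 - x\<^sup>2) - 3 * (x * 1)) * sqrt (4 - x\<^sup>2)) has_integral 0) {-2..2}"
    by (rule semicircle_moment_by_parts[of "\<lambda>x. 1"]) (auto intro!: derivative_eq_intros)
  then have "((\<lambda>x. - 3 * (x ^ Suc 0 * sqrt (4 - x\<^sup>2))) has_integral 0) {-2..2}"
    by (simp add: mult.assoc)
  moreover have "((\<lambda>x. - 3 * (x ^ Suc 0 * sqrt (4 - x\<^sup>2))) has_integral - 3 * semicircle_moment (Suc 0)) {-2..2}"
    by (intro has_integral_mult_right semicircle_moment_integral)
  ultimately have "0 = - 3 * semicircle_moment (Suc 0)"
    by (rule has_integral_unique)
  then show ?thesis by simp
qed

text \<open>The value is the area of a half disc of radius 2, obtained from the explicit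
  antiderivative \<open>?F\<close>.\<close>

lemma semicircle_moment_0: "semicircle_moment 0 = 2 * pi"
proof -
  let ?F = "\<lambda>x::real. x * sqrt (4 - x\<^sup>2) / 2 + 2 * arcsin (x / 2)"
  have "continuous_on {-2..2} ?F"
    by (intro continuous_intros) auto
  moreover have "(?F has_vector_derivative sqrt (4 - x\<^sup>2)) (at x)" if x: "x \<in> {-2<..<2}" for x
  proof -
    have pos: "0 < 4 - x\<^sup>2" by (rule four_minus_square_pos[OF x])
    define s where "s = sqrt (4 - x\<^sup>2)"
    have s: "s > 0" "x\<^sup>2 = 4 - s\<^sup>2" using pos by (simp_all add: s_def)
    have half: "sqrt (1 - (x / 2)\<^sup>2) = s / 2"
    proof -
      have eq: "1 - (x / 2)\<^sup>2 = (4 - x\<^sup>2) / 4" by (simp add: power_divide field_simps)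
      show ?thesis unfolding s_def eq by (simp add: real_sqrt_divide)
    qed
    have "(?F has_real_derivative (s + x * ((- 2 * x) / (2 * s))) / 2 + 2 * ((1 / 2) / sqrt (1 - (x / 2)\<^sup>2))) (at x)"
      using pos x unfolding s_def
      by (auto intro!: derivative_eq_intros simp: field_simps)
    moreover have "(s + x * ((- 2 * x) / (2 * s))) / 2 + 2 * ((1 / 2) / sqrt (1 - (x / 2)\<^sup>2)) = s"
      unfolding half using s by (simp add: field_simps power2_eq_square)
    ultimately show ?thesis
      by (simp add: has_real_derivative_iff_has_vector_derivative[symmetric] s_def)
  qed
  ultimately have "((\<lambda>x. sqrt (4 - x\<^sup>2)) has_integral ?F 2 - ?F (-2)) {-2..2}"
    by (intro fundamental_theorem_of_calculus_interior) auto
  moreover have "?F 2 - ?F (-2) = 2 * pi" by (simp add: arcsin_minus)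
  moreover have "((\<lambda>x. sqrt (4 - x\<^sup>2)) has_integral semicircle_moment 0) {-2..2}"
    using semicircle_moment_integral[of 0] by simp
  ultimately show ?thesis
    by (metis has_integral_unique)
qed

text \<open>Both sequences satisfy the same two-step recurrence, whose leading coefficient
  \<open>m + 4\<close> is nonzero, and up to the factor \<open>2 * pi\<close> they agree at 0 and
  1.\<close>

theorem semicircular_moment_eq_card_NC2: "(\<integral>x. x ^ m \<partial>semicircular 1) = card (NC2 m)"
proof -
  have "semicircle_moment m = 2 * pi * card (NC2 m)"
  proof (induction m rule: induct_nat_012)
    case (ge2 m)
    have "real (m + 4) * semicircle_moment (m + 2) = real (m + 4) * (2 * pi * card (NC2 (m + 2)))"
      using semicircle_moment_recurrence[of m] card_NC2_recurrence[of m] ge2(1)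
      by (simp add: mult.left_commute)
    then show ?case by simp
  qed (simp_all add: semicircle_moment_0 semicircle_moment_1 card_NC2_0 card_NC2_1)
  then show ?thesis by (simp add: semicircular_moment)
qed

section \<open>The limit of the moments\<close>

text \<open>The factors need not commute, so the power expands over words rather than over
  multi-indices.\<close>

lemma sum_power_words:
  fixes x :: "'i \<Rightarrow> 'a::semiring_1"
  assumes "finite A"
  shows "(\<Sum>k\<in>A. x k) ^ m = (\<Sum>w | set w \<subseteq> A \<and> length w = m. prod_list (map x w))"
proof (induction m)
  case 0
  have "{w. set w \<subseteq> A \<and> length w = 0} = {[]}" by auto
  then show ?case by simp
next
  case (Suc m)
  let ?W = "{w. set w \<subseteq> A \<and> length w = m}"
  have "(\<Sum>w | set w \<subseteq> A \<and> length w = Suc m. prod_list (map x w))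
      = (\<Sum>(w, k)\<in>?W \<times> A. x k * prod_list (map x w))"
    unfolding lists_length_Suc_eq
    by (subst sum.reindex) (auto simp: inj_on_def case_prod_unfold)
  also have "\<dots> = (\<Sum>w\<in>?W. \<Sum>k\<in>A. x k * prod_list (map x w))"
    by (rule sum.cartesian_product[symmetric])
  also have "\<dots> = (\<Sum>k\<in>A. x k) * (\<Sum>w\<in>?W. prod_list (map x w))"
    by (simp add: sum_distrib_left sum_distrib_right sum.swap[of _ ?W])
  finally show ?case by (simp add: Suc)
qed

lemma prod_list_tens:
  assumes "cstar_tensor_product tens"
  shows "prod_list (map (\<lambda>k. tens (x k) (y k)) w) = tens (prod_list (map x w)) (prod_list (map y w))"
  using assms by (induction w) (simp_all add: cstar_tensor_product_def)

section \<open>Asymptotics of the number of words with a given kernel\<close>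

lemma falling_factorial_ratio_tendsto:
  "(\<lambda>n. real (\<Prod>i<k. n - i) / real n ^ k) \<longlonglongrightarrow> 1"
proof -
  \<comment> \<open>Truncated subtraction is harmless, since \<open>n\<close> eventually exceeds
    \<open>i\<close>.\<close>
  have "(\<lambda>n. real (n - i) / real n) \<longlonglongrightarrow> 1" for i
  proof (rule Lim_transform_eventually)
    show "(\<lambda>n. 1 - real i / real n) \<longlonglongrightarrow> 1"
      using tendsto_diff[OF tendsto_const lim_const_over_n[of "real i"], of 1] by simp
    show "\<forall>\<^sub>F n in sequentially. 1 - real i / real n = real (n - i) / real n"
      using eventually_ge_at_top[of "Suc i"]
      by eventually_elim (simp add: of_nat_diff diff_divide_distrib)
  qed
  then have "(\<lambda>n. \<Prod>i<k. real (n - i) / real n) \<longlonglongrightarrow> (\<Prod>i<k. 1)"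
    by (intro tendsto_prod)
  then show ?thesis by (simp add: prod_dividef)
qed

text \<open>Of the \<open>m\<close> factors \<open>1 / sqrt n\<close>, \<open>2 * k\<close>
  normalize the falling factorial to limit 1; the other \<open>m - 2 * k\<close> force the limit 0
  unless there are none, where \<open>0 ^ 0 = 1\<close>.\<close>

lemma normalized_falling_factorial_tendsto:
  assumes "2 * k \<le> m"
  shows "(\<lambda>n. real (\<Prod>i<k. n - i) * (1 / sqrt (real n)) ^ m) \<longlonglongrightarrow> (if 2 * k = m then 1 else 0)"
proof (rule Lim_transform_eventually)
  have "(\<lambda>n. 1 / sqrt (real n)) \<longlonglongrightarrow> 0"
    by (rule real_tendsto_divide_at_top[OF tendsto_const])
      (intro filterlim_compose[OF sqrt_at_top] filterlim_real_sequentially)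
  then have "(\<lambda>n. (1 / sqrt (real n)) ^ (m - 2 * k)) \<longlonglongrightarrow> 0 ^ (m - 2 * k)"
    by (intro tendsto_power)
  also have "(0::real) ^ (m - 2 * k) = (if 2 * k = m then 1 else 0)"
    using assms by (auto simp: power_0_left)
  finally have "(\<lambda>n. (1 / sqrt (real n)) ^ (m - 2 * k)) \<longlonglongrightarrow> (if 2 * k = m then 1 else 0)" .
  from tendsto_mult[OF falling_factorial_ratio_tendsto[of k] this]
  show "(\<lambda>n. real (\<Prod>i<k. n - i) / real n ^ k * (1 / sqrt (real n)) ^ (m - 2 * k)) \<longlonglongrightarrow> (if 2 * k = m then 1 else 0)"
    by simp
  show "\<forall>\<^sub>F n in sequentially. real (\<Prod>i<k. n - i) / real n ^ k * (1 / sqrt (real n)) ^ (m - 2 * k)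
      = real (\<Prod>i<k. n - i) * (1 / sqrt (real n)) ^ m"
    using eventually_gt_at_top[of 0]
  proof eventually_elim
    case (elim n)
    have "(1 / sqrt (real n)) ^ m = (1 / sqrt (real n)) ^ (2 * k + (m - 2 * k))"
      using assms by simp
    also have "\<dots> = ((1 / sqrt (real n))\<^sup>2) ^ k * (1 / sqrt (real n)) ^ (m - 2 * k)"
      by (simp only: power_add power_mult)
    also have "(1 / sqrt (real n))\<^sup>2 = 1 / real n"
      by (simp add: power_divide)
    finally show ?case by (simp add: power_divide)
  qed
qed

text \<open>An injective renaming \<open>f\<close> takes \<open>w\<close> to \<open>v\<close>. On
  the letters of \<open>w\<close> the families \<open>\<lambda>c. x (f c)\<close> and
  \<open>x\<close> are both free with equal single distributions, so their joint moments
  agree.\<close>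

lemma free_copies_moment_kernel:
  assumes st: "state \<phi>" and x: "free_copies \<phi> a x"
    and v: "set v \<subseteq> {1..}" and w: "set w \<subseteq> {1..}"
    and len: "length v = length w" and ker: "kernel v = kernel w"
  shows "\<phi> (prod_list (map x v)) = \<phi> (prod_list (map x w))"
proof -
  obtain f where f: "inj_on f (set w)" "v = map f w"
    using len ker by (rule kernel_eq_imp_map)
  have free: "freely_independent \<phi> {1..} x" and same: "\<And>k. k \<ge> 1 \<Longrightarrow> same_distribution \<phi> (x k) a"
    using x by (auto simp: free_copies_def)
  have fw: "f c \<ge> 1" if "c \<in> set w" for c
    using that v f by auto
  have "freely_independent \<phi> (set w) (\<lambda>c. x (f c))"
    unfolding freely_independent_def free_subalgebras_def
  proof (intro allI impI, elim conjE)
    fix "is" and xs :: "'a list"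
    assume *: "is \<noteq> []" "length xs = length is" "set is \<subseteq> set w" "distinct_adj is"
      "\<forall>j<length is. xs ! j \<in> generated_algebra (x (f (is ! j))) \<and> \<phi> (xs ! j) = 0"
    \<comment> \<open>Injectivity keeps neighbouring indices distinct, so freeness of
      \<open>x\<close> applies along the renamed indices.\<close>
    have "distinct_adj (map f is)"
      using *(3,4) f(1) by (intro distinct_adj_mapI) (auto intro: inj_on_subset)
    moreover have "set (map f is) \<subseteq> {1..}" using fw *(3) by auto
    ultimately show "\<phi> (prod_list xs) = 0"
      using free * unfolding freely_independent_def free_subalgebras_def
      by (elim allE[of _ "map f is"] allE[of _ xs]) simp
  qed
  moreover have "freely_independent \<phi> (set w) x"
    using free w unfolding freely_independent_def free_subalgebras_def by blast
  moreover have "same_distribution \<phi> (x (f c)) (x c)" if "c \<in> set w" for c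
    using same[of "f c"] same[of c] fw[OF that] w that by (auto simp: same_distribution_def)
  ultimately have "\<phi> (prod_list (map (\<lambda>c. x (f c)) w)) = \<phi> (prod_list (map x w))"
    by (rule free_joint_moments_eq[OF st _ _ _ order_refl])
  then show ?thesis by (simp add: f comp_def)
qed

lemma
  assumes st: "state \<phi>" and x: "free_copies \<phi> a x" and a: "\<phi> a = 0" and w: "set w \<subseteq> {1..}"
  shows free_copies_moment_singleton: "c \<in> set w \<Longrightarrow> count_list w c = 1 \<Longrightarrow> \<phi> (prod_list (map x w)) = 0"
    and free_copies_moment_paired: "paired w \<Longrightarrow>
      \<phi> (prod_list (map x w)) = (if crossing w then 0 else \<phi> (a\<^sup>2) ^ (length w div 2))"
proof -
  have free: "freely_independent \<phi> {1..} x" and same: "\<And>k p. k \<in> {1..} \<Longrightarrow> \<phi> (x k ^ p) = \<phi> (a ^ p)"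
    using x by (auto simp: free_copies_def same_distribution_def)
  have mean: "\<phi> (x k) = 0" if "k \<in> {1..}" for k
    using same[OF that, of 1] a by simp
  show "\<phi> (prod_list (map x w)) = (if crossing w then 0 else \<phi> (a\<^sup>2) ^ (length w div 2))" if "paired w"
    by (rule free_moment_paired[OF st free mean same w that])
  show "\<phi> (prod_list (map x w)) = 0" if c: "c \<in> set w" "count_list w c = 1"
  proof -
    obtain u v where uv: "w = u @ c # v" using split_list[OF c(1)] by blast
    have "c \<notin> set u \<union> set v" using c(2) by (simp add: uv count_list_0_iff)
    then show ?thesis
      unfolding uv using c(1) w
      by (intro free_moment_singleton[OF st free]) (auto simp: uv intro: mean)
  qed
qed

text \<open>Every letter occurs at least twice and the multiplicities add up to the length; equality
  means that no multiplicity exceeds two.\<close>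

lemma card_set_le_half_length:
  assumes "\<And>c. c \<in> set w \<Longrightarrow> count_list w c \<noteq> 1"
  shows "2 * card (set w) \<le> length w" and "2 * card (set w) = length w \<longleftrightarrow> paired w"
proof -
  have ge: "2 \<le> count_list w c" if "c \<in> set w" for c
    using assms[OF that] that by (metis One_nat_def count_list_0_iff less_2_cases not_le)
  have sum: "(\<Sum>c\<in>set w. count_list w c) = length w" by (rule sum_count_set) auto
  have "(\<Sum>c\<in>set w. 2) \<le> (\<Sum>c\<in>set w. count_list w c)" by (rule sum_mono[OF ge])
  then show "2 * card (set w) \<le> length w" by (simp add: sum)
  have "(\<Sum>c\<in>set w. count_list w c) = (\<Sum>c\<in>set w. count_list w c - 2) + (\<Sum>c\<in>set w. 2)"
    unfolding sum.distrib[symmetric] by (intro sum.cong refl) (use ge in fastforce)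
  then have "2 * card (set w) = length w \<longleftrightarrow> (\<Sum>c\<in>set w. count_list w c - 2) = 0"
    by (simp add: sum)
  also have "\<dots> \<longleftrightarrow> paired w"
    unfolding paired_def using ge by (auto intro: antisym)
  finally show "2 * card (set w) = length w \<longleftrightarrow> paired w" .
qed

section \<open>Summation over kernels\<close>

definition partitions :: "nat \<Rightarrow> nat set set set" where
  "partitions m = {P. partition_on {1..m} P}"

lemma finite_partitions: "finite (partitions m)"
  by (rule finite_subset[of _ "Pow (Pow {1..m})"]) (auto simp: partitions_def partition_on_def)

lemma kernel_representative:
  assumes "P \<in> partitions m"
  obtains w :: "nat list" where "set w \<subseteq> {1..}" "length w = m" "kernel w = P"
proof -
  obtain w :: "nat list" where "length w = m" "kernel w = P"
    using assms partition_on_imp_kernel unfolding partitions_def by blast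
  then show ?thesis
    using kernel_map[of Suc w] that[of "map Suc w"] by auto
qed

text \<open>All words with kernel \<open>P\<close> contribute the same constant. A singleton block
  makes it 0; otherwise \<open>P\<close> has at most \<open>m / 2\<close> blocks, and the normalized
  number of words tends to 1 for pairings and to 0 for the rest.\<close>

lemma partition_contribution_tendsto:
  fixes \<phi> :: "'a::cstar_algebra \<Rightarrow> complex"
  assumes st: "state \<phi>" and x: "free_copies \<phi> a x" "\<phi> a = 0" and y: "free_copies \<phi> b y" "\<phi> b = 0"
    and P: "P \<in> partitions m"
  shows "(\<lambda>n. of_real ((1 / sqrt (real n)) ^ m) *
      (\<Sum>w | set w \<subseteq> {1..n} \<and> length w = m \<and> kernel w = P.
        \<phi> (prod_list (map x w)) * \<phi> (prod_list (map y w))))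
    \<longlonglongrightarrow> (if P \<in> NC2 m then \<phi> (a\<^sup>2) ^ (m div 2) * \<phi> (b\<^sup>2) ^ (m div 2) else 0)"
proof -
  \<comment> \<open>The representative is drawn from all positive letters, so \<open>?c\<close> does
    not depend on \<open>n\<close>.\<close>
  obtain v :: "nat list" where v: "set v \<subseteq> {1..}" "length v = m" "kernel v = P"
    using P by (rule kernel_representative)
  let ?k = "card (set v)"
  let ?c = "\<phi> (prod_list (map x v)) * \<phi> (prod_list (map y v))"
  have "(\<Sum>w | set w \<subseteq> {1..n} \<and> length w = m \<and> kernel w = P.
        \<phi> (prod_list (map x w)) * \<phi> (prod_list (map y w))) = of_nat (\<Prod>i<?k. n - i) * ?c" for n
  proof -
    let ?W = "{w. set w \<subseteq> {1..n} \<and> length w = m \<and> kernel w = P}"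
    have "\<phi> (prod_list (map x w)) * \<phi> (prod_list (map y w)) = ?c" if "w \<in> ?W" for w
    proof -
      have w: "set w \<subseteq> {1..}" "length w = length v" "kernel w = kernel v" using that v by auto
      show ?thesis
        using free_copies_moment_kernel[OF st x(1) w(1) v(1) w(2,3)]
          free_copies_moment_kernel[OF st y(1) w(1) v(1) w(2,3)] by simp
    qed
    then have "(\<Sum>w\<in>?W. \<phi> (prod_list (map x w)) * \<phi> (prod_list (map y w))) = of_nat (card ?W) * ?c"
      by simp
    also have "card ?W = (\<Prod>i<?k. n - i)"
      using card_words_with_kernel[of "{1..n}" v] v by simp
    finally show ?thesis .
  qed
  then have eq: "of_real ((1 / sqrt (real n)) ^ m) *
      (\<Sum>w | set w \<subseteq> {1..n} \<and> length w = m \<and> kernel w = P.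
        \<phi> (prod_list (map x w)) * \<phi> (prod_list (map y w)))
      = of_real (real (\<Prod>i<?k. n - i) * (1 / sqrt (real n)) ^ m) * ?c" for n
    by (simp add: mult_ac)
  have NC: "P \<in> NC2 m \<longleftrightarrow> paired v \<and> \<not> crossing v"
    using P v(2,3) by (intro NC2_eq_kernel) (auto simp: partitions_def)
  show ?thesis
  proof (cases "\<exists>c\<in>set v. count_list v c = 1")
    case True
    then have c: "?c = 0"
      using free_copies_moment_singleton[OF st x v(1)] by auto
    have "P \<notin> NC2 m" using True NC by (auto simp: paired_def)
    then show ?thesis unfolding eq c by simp
  next
    case False
    then have half: "2 * ?k \<le> m" and half_iff: "2 * ?k = m \<longleftrightarrow> paired v"
      using card_set_le_half_length[of v] v(2) by auto
    have "(\<lambda>n. of_real (real (\<Prod>i<?k. n - i) * (1 / sqrt (real n)) ^ m) * ?c)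
      \<longlonglongrightarrow> of_real (if 2 * ?k = m then 1 else 0) * ?c"
      by (intro tendsto_mult tendsto_of_real tendsto_const normalized_falling_factorial_tendsto half)
    moreover have "of_real (if 2 * ?k = m then 1 else 0) * ?c =
        (if P \<in> NC2 m then \<phi> (a\<^sup>2) ^ (m div 2) * \<phi> (b\<^sup>2) ^ (m div 2) else 0)"
      using free_copies_moment_paired[OF st x v(1)] free_copies_moment_paired[OF st y v(1)] v(2)
      by (simp add: half_iff NC)
    ultimately show ?thesis unfolding eq by simp
  qed
qed

text \<open>Products of the \<open>tens (x k) (y k)\<close> are again simple tensors, on which
  \<open>\<psi>\<close> factorizes, so the two families meet only through a common word.\<close>

lemma normalized_tensor_sum_moment:
  fixes \<phi> :: "'a::cstar_algebra \<Rightarrow> complex"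
  assumes tens: "cstar_tensor_product tens" and \<psi>: "product_state tens \<phi> \<phi> \<psi>"
  shows "\<psi> (normalized_tensor_sum tens x y n ^ m) = of_real ((1 / sqrt (real n)) ^ m) *
    (\<Sum>w | set w \<subseteq> {1..n} \<and> length w = m. \<phi> (prod_list (map x w)) * \<phi> (prod_list (map y w)))"
proof -
  have st: "state \<psi>" and prod: "\<And>u v. \<psi> (tens u v) = \<phi> u * \<phi> v"
    using \<psi> by (auto simp: product_state_def)
  have "normalized_tensor_sum tens x y n ^ m = (1 / sqrt (real n)) ^ m *\<^sub>R
    (\<Sum>w | set w \<subseteq> {1..n} \<and> length w = m. tens (prod_list (map x w)) (prod_list (map y w)))"
    by (simp only: normalized_tensor_sum_def scaleR_power sum_power_words[OF finite_atLeastAtMost]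
        prod_list_tens[OF tens])
  then show ?thesis
    by (simp only: state_scaleR[OF st] state_sum[OF st] prod)
qed

text \<open>Words are grouped by kernel. The set \<open>partitions m\<close> is finite and
  independent of \<open>n\<close>, so the limit passes through the sum, and only the members of
  \<open>NC2 m\<close> remain.\<close>

theorem tensor_free_clt:
  fixes \<phi> :: "'a::cstar_algebra \<Rightarrow> complex"
  assumes st: "state \<phi>" and tens: "cstar_tensor_product tens" and \<psi>: "product_state tens \<phi> \<phi> \<psi>"
    and x: "free_copies \<phi> a x" "\<phi> a = 0" and y: "free_copies \<phi> b y" "\<phi> b = 0"
  shows "(\<lambda>n. \<psi> (normalized_tensor_sum tens x y n ^ m))
    \<longlonglongrightarrow> of_nat (card (NC2 m)) * \<phi> (a\<^sup>2) ^ (m div 2) * \<phi> (b\<^sup>2) ^ (m div 2)"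
proof -
  let ?f = "\<lambda>w. \<phi> (prod_list (map x w)) * \<phi> (prod_list (map y w))"
  have "\<psi> (normalized_tensor_sum tens x y n ^ m) = (\<Sum>P\<in>partitions m.
      of_real ((1 / sqrt (real n)) ^ m) *
      (\<Sum>w | set w \<subseteq> {1..n} \<and> length w = m \<and> kernel w = P. ?f w))" for n
  proof -
    have "(\<Sum>w | set w \<subseteq> {1..n} \<and> length w = m. ?f w) =
      (\<Sum>P\<in>partitions m. \<Sum>w\<in>{w\<in>{w. set w \<subseteq> {1..n} \<and> length w = m}. kernel w = P}. ?f w)"
      using partition_on_kernel
      by (intro sum.group[symmetric] finite_lists_length_eq finite_partitions)
        (auto simp: partitions_def)
    then show ?thesis
      by (simp add: normalized_tensor_sum_moment[OF tens \<psi>] sum_distrib_left conj_assoc)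
  qed
  moreover have "(\<lambda>n. \<Sum>P\<in>partitions m.
      of_real ((1 / sqrt (real n)) ^ m) *
      (\<Sum>w | set w \<subseteq> {1..n} \<and> length w = m \<and> kernel w = P. ?f w))
    \<longlonglongrightarrow> (\<Sum>P\<in>partitions m. if P \<in> NC2 m then \<phi> (a\<^sup>2) ^ (m div 2) * \<phi> (b\<^sup>2) ^ (m div 2) else 0)"
    by (intro tendsto_sum partition_contribution_tendsto[OF st x y])
  moreover have "partitions m \<inter> NC2 m = NC2 m"
    by (auto simp: partitions_def NC2_def)
  ultimately show ?thesis
    by (simp add: sum.If_cases finite_partitions mult.assoc)
qed

lemma NC2_odd: "odd m \<Longrightarrow> NC2 m = {}"
proof (rule ccontr)
  assume m: "odd m" and "NC2 m \<noteq> {}"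
  then obtain P where P: "partition_on {1..m} P" "\<forall>V\<in>P. card V = 2"
    by (auto simp: NC2_def)
  then have "card {1..m} = (\<Sum>V\<in>P. card V)"
    by (intro product_partition) (auto intro: card_ge_0_finite)
  then have "m = 2 * card P" using P(2) by simp
  then show False using m by simp
qed

theorem theorem4p1:
  fixes \<phi> :: "'a::cstar_algebra \<Rightarrow> complex"
    and tens :: "'a \<Rightarrow> 'a \<Rightarrow> 't::cstar_algebra"
    and \<psi> :: "'t \<Rightarrow> complex"
    and a b :: 'a
    and as bs :: "nat \<Rightarrow> 'a"
  assumes "state \<phi>"
    and "cstar_tensor_product tens"
    and "product_state tens \<phi> \<phi> \<psi>"
    and "\<phi> a = 0" and "\<phi> b = 0"
    and "free_copies \<phi> a as"
    and "free_copies \<phi> b bs"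
  shows "(\<forall>m::nat. (\<lambda>n. \<psi> (normalized_tensor_sum tens as bs n ^ m)) \<longlonglongrightarrow>
            (if odd m then 0
             else of_nat (card (NC2 m)) * \<phi> (a\<^sup>2) ^ (m div 2) * \<phi> (b\<^sup>2) ^ (m div 2)))
       \<and> (self_adjoint a \<and> self_adjoint b \<and> variance \<phi> a = 1 \<and> variance \<phi> b = 1
            \<longrightarrow> limit_distribution \<psi> (normalized_tensor_sum tens as bs) (semicircular 1))"
proof -
  note clt = tensor_free_clt[OF assms(1-3,6,4,7,5)]
  have "(\<lambda>n. \<psi> (normalized_tensor_sum tens as bs n ^ m)) \<longlonglongrightarrow>
      (if odd m then 0
       else of_nat (card (NC2 m)) * \<phi> (a\<^sup>2) ^ (m div 2) * \<phi> (b\<^sup>2) ^ (m div 2))" for m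
    using clt[of m] NC2_odd[of m] by (cases "odd m") simp_all
  moreover have "limit_distribution \<psi> (normalized_tensor_sum tens as bs) (semicircular 1)"
    if "variance \<phi> a = 1" "variance \<phi> b = 1"
  proof -
    have "\<phi> (a\<^sup>2) = 1" "\<phi> (b\<^sup>2) = 1"
      using that assms(4,5) by (simp_all add: variance_def)
    \<comment> \<open>With second moments 1 the limit is \<open>card (NC2 m)\<close> for every
      \<open>m\<close>, even or odd, which is the semicircular moment.\<close>
    then show ?thesis
      using clt by (simp add: limit_distribution_def semicircular_moment_eq_card_NC2)
  qed
  ultimately show ?thesis by blast
qed

end
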